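(* Let $V$ be a finite-dimensional vector space over a field $\mathbb{K}$, and let $A$ and $B$ be extensors in $\Lambda(V)$, with corresponding subspaces $\overline{A},\overline{B}\subseteq V$. (1) Let $p=\dim\overline{A}-\dim(\overline{A}\cap\overline{B})=\dim(\overline{A}+\overline{B})-\dim\overline{B}$ be the common dimension of the isomorphic intervals $[\overline{A}\cap\overline{B},\overline{A}]\cong[\overline{B},\overline{A}+\overline{B}]$ of the lattice of subspaces of $V$. Then: - for $h=p$, one has $\diamond^{(h)}_{21}(A\otimes B)=C\otimes D$ for some extensors $C,D$ with $\overline{C}=\overline{A}\cap\overline{B}$ and $\overline{D}=\overline{A}+\overline{B}$; - for every integer $h>p$, one has $\diamond^{(h)}_{21}(A\otimes B)=0$. (2) Let $p'=\dim\overline{B}-\dim(\overline{A}\cap\overline{B})$. Then: - for $h=p'$, one has $\diamond^{(h)}_{12}(A\otimes B)=C'\otimes D'$ for some extensors $C',D'$ with $\overline{C'}=\overline{A}+\overline{B}$ and $\overline{D'}=\overline{A}\cap\overline{B}$; - for every integer $h>p'$, one has $\diamond^{(h)}_{12}(A\otimes B)=0$.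
   Context: $\Lambda(V)$ is the exterior algebra of $V$; its product is written by juxtaposition. An extensor of step $k$ is a nonzero element $A\in\Lambda(V)$ that can be written as a product $v_1v_2\cdots v_k$ of $k$ vectors of $V$ (for $k=0$: a nonzero scalar); then $\overline{A}$ denotes the $k$-dimensional subspace spanned by $v_1,\dots,v_k$, which depends only on $A$. For an extensor $A=v_1\cdots v_a$ and integers $i,j\ge 0$ with $i+j=a$, the coproduct slice is $$\sum_{(A)_{(i,j)}}A_{(1)}\otimes A_{(2)}=\sum_{I}\operatorname{sgn}(I,J)\;v_I\otimes v_J\in\Lambda(V)\otimes\Lambda(V),$$ where $I$ runs over the $i$-element subsets of $\{1,\dots,a\}$, $J$ is the complement of $I$, $v_I$ and $v_J$ are the products of the corresponding vectors in increasing order of index, and $\operatorname{sgn}(I,J)$ is the sign of the permutation listing $I$ increasingly followed by $J$ increasingly. It is the $(i,j)$-homogeneous component of the usual coproduct of $\Lambda(V)$ and depends only on $A$. If $i<0$ or $j<0$ the slice is $0$. For an integer $h\ge 0$, the geometric products $\diamond^{(h)}_{21},\diamond^{(h)}_{12}:\Lambda(V)\otimes\Lambda(V)\to\Lambda(V)\otimes\Lambda(V)$ are the linear operators defined, for extensors $A,B$ of steps $a,b$, by $$\diamond^{(h)}_{21}(A\otimes B)=\sum_{(A)_{(a-h,h)}}A_{(1)}\otimes A_{(2)}B,\qquad \diamond^{(h)}_{12}(A\otimes B)=\sum_{(B)_{(h,b-h)}}AB_{(1)}\otimes B_{(2)}.$$ *)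

theory Defs
  imports
    Complex_Main
    "HOL-Library.Poly_Mapping"
    "HOL-Library.Product_Plus"
    "HOL-Library.Set_Algebras"
    "HOL-Combinatorics.Permutations"
begin

section \<open>Free vector spaces and the free algebra on a set\<close>

text \<open>
  \<^typ>\<open>'x \<Rightarrow>\<^sub>0 'k\<close> is the free \<open>'k\<close>-vector space on \<open>'x\<close>. Words carry concatenation as monoid
  structure, so that the convolution product of the library makes \<open>'x word \<Rightarrow>\<^sub>0 'k\<close> the free
  associative unital algebra on \<open>'x\<close>. (A wrapper type is used because some library theories put a
  pointwise addition on lists.)
\<close>

datatype 'v word = Word (letters: "'v list")

instantiation word :: (type) monoid_add
begin

definition zero_word :: "'a word" where
  "0 = Word []"

definition plus_word :: "'a word \<Rightarrow> 'a word \<Rightarrow> 'a word" where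
  "u + w = Word (letters u @ letters w)"

instance
  by standard (simp_all add: zero_word_def plus_word_def)

end

definition fscale :: "'k::field \<Rightarrow> ('x \<Rightarrow>\<^sub>0 'k) \<Rightarrow> ('x \<Rightarrow>\<^sub>0 'k)" where
  "fscale c p = Poly_Mapping.map ((*) c) p"

lemma lookup_fscale [simp]: "Poly_Mapping.lookup (fscale c p) x = c * Poly_Mapping.lookup p x"
  by (simp add: fscale_def Poly_Mapping.map.rep_eq when_def)

interpretation free: vector_space "fscale :: 'k::field \<Rightarrow> ('x \<Rightarrow>\<^sub>0 'k) \<Rightarrow> ('x \<Rightarrow>\<^sub>0 'k)"
  by standard (simp_all add: poly_mapping_eq_iff fun_eq_iff lookup_add algebra_simps)

text \<open>The linear extension of a map given on the standard basis.\<close>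

definition lin_ext :: "('x \<Rightarrow> ('y \<Rightarrow>\<^sub>0 'k)) \<Rightarrow> ('x \<Rightarrow>\<^sub>0 'k::field) \<Rightarrow> ('y \<Rightarrow>\<^sub>0 'k)" where
  "lin_ext f p = (\<Sum>x\<in>Poly_Mapping.keys p. fscale (Poly_Mapping.lookup p x) (f x))"

definition gen :: "'v \<Rightarrow> ('v word \<Rightarrow>\<^sub>0 'k::field)" where
  "gen v = Poly_Mapping.single (Word [v]) 1"


section \<open>The exterior algebra\<close>

text \<open>
  The vector space \<open>V\<close> is given by its scalar multiplication \<open>scale\<close> on the type \<open>'v\<close>. Dividing the
  free algebra on the set \<open>V\<close> by the first two families of relations gives the tensor algebra
  \<open>T(V)\<close>; the third family gives \<open>\<Lambda>(V) = T(V) / (x \<otimes> x)\<close>. Elements of \<open>\<Lambda>(V)\<close> are cosets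
  \<open>p +o ext_ideal scale\<close>; the zero of \<open>\<Lambda>(V)\<close> is therefore \<open>ext_ideal scale\<close> itself
  (and not the zero of \<^theory>\<open>HOL-Library.Set_Algebras\<close>).
\<close>

definition ext_rels :: "('k::field \<Rightarrow> 'v::ab_group_add \<Rightarrow> 'v) \<Rightarrow> ('v word \<Rightarrow>\<^sub>0 'k) set" where
  "ext_rels scale =
     {gen (x + y) - gen x - gen y | x y. True}
   \<union> {gen (scale c x) - fscale c (gen x) | c x. True}
   \<union> {gen x * gen x | x. True}"

text \<open>The two-sided ideal generated by the relations.\<close>

definition ext_ideal :: "('k::field \<Rightarrow> 'v::ab_group_add \<Rightarrow> 'v) \<Rightarrow> ('v word \<Rightarrow>\<^sub>0 'k) set" where
  "ext_ideal scale = free.span {p * r * q | p r q. r \<in> ext_rels scale}"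

definition ext_class ::
  "('k::field \<Rightarrow> 'v::ab_group_add \<Rightarrow> 'v) \<Rightarrow> ('v word \<Rightarrow>\<^sub>0 'k) \<Rightarrow> ('v word \<Rightarrow>\<^sub>0 'k) set" where
  "ext_class scale p = p +o ext_ideal scale"

definition ext_zero :: "('k::field \<Rightarrow> 'v::ab_group_add \<Rightarrow> 'v) \<Rightarrow> ('v word \<Rightarrow>\<^sub>0 'k) set" where
  "ext_zero scale = ext_class scale 0"

text \<open>
  The product of two cosets. The Minkowski product of two cosets need not be a full coset, hence
  the union; it is a single coset by \<open>ext_mult_class\<close> below. The other
  operations on cosets are defined in the same way, see \<open>ext_tensor_class\<close>,
  \<open>diamond21_class\<close> and \<open>diamond12_class\<close>.
\<close>

definition ext_mult ::
  "('k::field \<Rightarrow> 'v::ab_group_add \<Rightarrow> 'v) \<Rightarrow>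
    ('v word \<Rightarrow>\<^sub>0 'k) set \<Rightarrow> ('v word \<Rightarrow>\<^sub>0 'k) set \<Rightarrow> ('v word \<Rightarrow>\<^sub>0 'k) set" where
  "ext_mult scale A B = (\<Union>a\<in>A. \<Union>b\<in>B. ext_class scale (a * b))"

definition wedge ::
  "('k::field \<Rightarrow> 'v::ab_group_add \<Rightarrow> 'v) \<Rightarrow> 'v list \<Rightarrow> ('v word \<Rightarrow>\<^sub>0 'k) set" where
  "wedge scale vs = foldr (\<lambda>v. ext_mult scale (ext_class scale (gen v))) vs (ext_class scale 1)"


section \<open>Extensors\<close>

text \<open>
  \<open>extensor_factors scale vs A\<close>: \<open>A\<close> is an extensor of step \<open>length vs\<close>, with vectors \<open>vs\<close>;
  extensors of step 0 are the nonzero scalars.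
\<close>

definition extensor_factors ::
  "('k::field \<Rightarrow> 'v::ab_group_add \<Rightarrow> 'v) \<Rightarrow> 'v list \<Rightarrow> ('v word \<Rightarrow>\<^sub>0 'k) set \<Rightarrow> bool" where
  "extensor_factors scale vs A \<longleftrightarrow> A \<noteq> ext_zero scale \<and>
     (if vs = [] then \<exists>c. A = ext_class scale (fscale c 1) else A = wedge scale vs)"

definition extensor ::
  "('k::field \<Rightarrow> 'v::ab_group_add \<Rightarrow> 'v) \<Rightarrow> ('v word \<Rightarrow>\<^sub>0 'k) set \<Rightarrow> bool" where
  "extensor scale A \<longleftrightarrow> (\<exists>vs. extensor_factors scale vs A)"

text \<open>The subspace spanned by the vectors of an extensor, which does not depend on their choice.\<close>

definition ext_space ::
  "('k::field \<Rightarrow> 'v::ab_group_add \<Rightarrow> 'v) \<Rightarrow> ('v word \<Rightarrow>\<^sub>0 'k) set \<Rightarrow> 'v set" where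
  "ext_space scale A =
     (THE W. \<exists>vs. extensor_factors scale vs A \<and> W = module.span scale (set vs))"


section \<open>The tensor square of the exterior algebra\<close>

text \<open>
  With \<open>F\<close> the free algebra on \<open>V\<close> and \<open>I = ext_ideal scale\<close>, the space \<open>F \<otimes> F\<close> is the free vector
  space on pairs of words, and
  \<open>\<Lambda>(V) \<otimes> \<Lambda>(V) = F/I \<otimes> F/I = (F \<otimes> F) / (I \<otimes> F + F \<otimes> I)\<close>.
\<close>

definition ftensor ::
  "('x \<Rightarrow>\<^sub>0 'k::field) \<Rightarrow> ('y \<Rightarrow>\<^sub>0 'k) \<Rightarrow> ('x \<times> 'y \<Rightarrow>\<^sub>0 'k)" where
  "ftensor p q = (\<Sum>x\<in>Poly_Mapping.keys p. \<Sum>y\<in>Poly_Mapping.keys q.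
     Poly_Mapping.single (x, y) (Poly_Mapping.lookup p x * Poly_Mapping.lookup q y))"

definition ext2_null ::
  "('k::field \<Rightarrow> 'v::ab_group_add \<Rightarrow> 'v) \<Rightarrow> ('v word \<times> 'v word \<Rightarrow>\<^sub>0 'k) set" where
  "ext2_null scale = free.span
     ({ftensor r q | r q. r \<in> ext_ideal scale} \<union> {ftensor p r | p r. r \<in> ext_ideal scale})"

definition ext2_class ::
  "('k::field \<Rightarrow> 'v::ab_group_add \<Rightarrow> 'v) \<Rightarrow>
    ('v word \<times> 'v word \<Rightarrow>\<^sub>0 'k) \<Rightarrow> ('v word \<times> 'v word \<Rightarrow>\<^sub>0 'k) set" where
  "ext2_class scale t = t +o ext2_null scale"

definition ext2_zero ::
  "('k::field \<Rightarrow> 'v::ab_group_add \<Rightarrow> 'v) \<Rightarrow> ('v word \<times> 'v word \<Rightarrow>\<^sub>0 'k) set" where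
  "ext2_zero scale = ext2_class scale 0"

definition ext_tensor ::
  "('k::field \<Rightarrow> 'v::ab_group_add \<Rightarrow> 'v) \<Rightarrow>
    ('v word \<Rightarrow>\<^sub>0 'k) set \<Rightarrow> ('v word \<Rightarrow>\<^sub>0 'k) set \<Rightarrow> ('v word \<times> 'v word \<Rightarrow>\<^sub>0 'k) set" where
  "ext_tensor scale A B = (\<Union>a\<in>A. \<Union>b\<in>B. ext2_class scale (ftensor a b))"


section \<open>Coproduct slices and geometric products\<close>

text \<open>
  Positions are numbered from 0. \<open>split_perm n I\<close> lists \<open>I\<close> increasingly, followed by its complement
  in \<open>{..<n}\<close> increasingly.
\<close>

definition split_perm :: "nat \<Rightarrow> nat set \<Rightarrow> nat \<Rightarrow> nat" where
  "split_perm n I k =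
     (if k < n then (sorted_list_of_set I @ sorted_list_of_set ({..<n} - I)) ! k else k)"

definition split_sign :: "nat \<Rightarrow> nat set \<Rightarrow> int" where
  "split_sign n I = sign (split_perm n I)"

text \<open>
  The \<open>(i,j)\<close> slice of a word; it vanishes by definition if \<open>i\<close> or \<open>j\<close> is negative or
  \<open>i + j\<close> is not the length of the word.
\<close>

definition slice :: "int \<Rightarrow> int \<Rightarrow> 'v word \<Rightarrow> ('v word \<times> 'v word \<Rightarrow>\<^sub>0 'k::field)" where
  "slice i j u = (let n = length (letters u) in
     \<Sum>I | I \<subseteq> {..<n} \<and> int (card I) = i \<and> int (card ({..<n} - I)) = j.
       Poly_Mapping.single
         (Word (nths (letters u) I), Word (nths (letters u) ({..<n} - I)))
         (of_int (split_sign n I)))"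

text \<open>
  The geometric products are given on pairs of words, extended linearly to \<open>F \<otimes> F\<close>, and passed to
  the quotient \<open>\<Lambda>(V) \<otimes> \<Lambda>(V)\<close>.
\<close>

definition word_diamond21 ::
  "nat \<Rightarrow> 'v word \<times> 'v word \<Rightarrow> ('v word \<times> 'v word \<Rightarrow>\<^sub>0 'k::field)" where
  "word_diamond21 h = (\<lambda>(u, w).
     lin_ext (\<lambda>(u1, u2). Poly_Mapping.single (u1, u2 + w) 1)
       (slice (int (length (letters u)) - int h) (int h) u))"

definition word_diamond12 ::
  "nat \<Rightarrow> 'v word \<times> 'v word \<Rightarrow> ('v word \<times> 'v word \<Rightarrow>\<^sub>0 'k::field)" where
  "word_diamond12 h = (\<lambda>(u, w).
     lin_ext (\<lambda>(w1, w2). Poly_Mapping.single (u + w1, w2) 1)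
       (slice (int h) (int (length (letters w)) - int h) w))"

definition diamond21 ::
  "('k::field \<Rightarrow> 'v::ab_group_add \<Rightarrow> 'v) \<Rightarrow> nat \<Rightarrow>
    ('v word \<times> 'v word \<Rightarrow>\<^sub>0 'k) set \<Rightarrow> ('v word \<times> 'v word \<Rightarrow>\<^sub>0 'k) set" where
  "diamond21 scale h X = (\<Union>x\<in>X. ext2_class scale (lin_ext (word_diamond21 h) x))"

definition diamond12 ::
  "('k::field \<Rightarrow> 'v::ab_group_add \<Rightarrow> 'v) \<Rightarrow> nat \<Rightarrow>
    ('v word \<times> 'v word \<Rightarrow>\<^sub>0 'k) set \<Rightarrow> ('v word \<times> 'v word \<Rightarrow>\<^sub>0 'k) set" where
  "diamond12 scale h X = (\<Union>x\<in>X. ext2_class scale (lin_ext (word_diamond12 h) x))"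


section \<open>The operations are well defined on the quotients\<close>

lemma fscale_single [simp]: "fscale c (Poly_Mapping.single x d) = Poly_Mapping.single x (c * d)"
  by (simp add: fscale_def)

lemma lin_ext_superset:
  assumes "finite K" "Poly_Mapping.keys p \<subseteq> K"
  shows "lin_ext f p = (\<Sum>x\<in>K. fscale (Poly_Mapping.lookup p x) (f x))"
  unfolding lin_ext_def using assms
  by (intro sum.mono_neutral_left) (auto simp: in_keys_iff)

lemma lin_ext_single [simp]: "lin_ext f (Poly_Mapping.single x c) = fscale c (f x)"
  by (subst lin_ext_superset[of "{x}"]) (auto split: if_splits)

lemma lin_ext_add: "lin_ext f (p + q) = lin_ext f p + lin_ext f q"
proof -
  let ?K = "Poly_Mapping.keys p \<union> Poly_Mapping.keys q"
  have "lin_ext f r = (\<Sum>x\<in>?K. fscale (Poly_Mapping.lookup r x) (f x))" if "r = p \<or> r = q \<or> r = p + q" for r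
    using that keys_add[of p q] by (intro lin_ext_superset) auto
  then show ?thesis by (simp add: lookup_add free.scale_left_distrib sum.distrib)
qed

lemma lin_ext_scale: "lin_ext f (fscale c p) = fscale c (lin_ext f p)"
proof -
  have "lin_ext f r = (\<Sum>x\<in>Poly_Mapping.keys p. fscale (Poly_Mapping.lookup r x) (f x))" if "r = p \<or> r = fscale c p" for r
    using that by (intro lin_ext_superset) (auto simp: in_keys_iff)
  then show ?thesis by (simp add: free.scale_sum_right)
qed

lemma lin_ext_linear: "Vector_Spaces.linear fscale fscale (lin_ext f)"
  by unfold_locales (auto simp: lin_ext_add lin_ext_scale)

lemma lin_ext_0 [simp]: "lin_ext f 0 = 0"
  by (simp add: lin_ext_def)

lemma lin_ext_diff: "lin_ext f (p - q) = lin_ext f p - lin_ext f q"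
  using lin_ext_add[of f "p - q" q] by simp

lemma lin_ext_sum: "lin_ext f (sum g K) = (\<Sum>x\<in>K. lin_ext f (g x))"
  by (induct K rule: infinite_finite_induct) (auto simp: lin_ext_add)

lemma free_induct:
  assumes "\<And>x c. P (Poly_Mapping.single x (c::'k::field))" "\<And>p q. P p \<Longrightarrow> P q \<Longrightarrow> P (p + q)"
  shows "P p"
proof -
  have "p = (\<Sum>x\<in>Poly_Mapping.keys p. Poly_Mapping.single x (Poly_Mapping.lookup p x))"
    by (rule poly_mapping_eqI) (auto simp: lookup_sum lookup_single when_def sum.delta in_keys_iff)
  moreover have "finite K \<Longrightarrow> P (\<Sum>x\<in>K. Poly_Mapping.single x (Poly_Mapping.lookup p x))" for K
    by (induct K rule: finite_induct) (use assms(1)[of undefined 0] in \<open>auto intro: assms\<close>)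
  ultimately show ?thesis by (metis finite_keys)
qed

lemma fscale_eq: "fscale c p = Poly_Mapping.single 0 c * p" for p :: "'x::monoid_add \<Rightarrow>\<^sub>0 'k::field"
  by (induct p rule: free_induct) (auto simp: mult_single free.scale_right_distrib distrib_left)

lemma fscale_eq': "fscale c p = p * Poly_Mapping.single 0 c" for p :: "'x::monoid_add \<Rightarrow>\<^sub>0 'k::field"
  by (induct p rule: free_induct) (auto simp: mult_single free.scale_right_distrib distrib_right mult.commute)

lemma fscale_mult_left: "fscale c p * q = fscale c (p * q)" for p q :: "'x::monoid_add \<Rightarrow>\<^sub>0 'k::field"
  by (simp add: fscale_eq mult.assoc)

lemma fscale_mult_right: "p * fscale c q = fscale c (p * q)" for p q :: "'x::monoid_add \<Rightarrow>\<^sub>0 'k::field"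
  by (simp add: fscale_eq' mult.assoc)

lemma ftensor_eq: "ftensor p q = lin_ext (\<lambda>x. lin_ext (\<lambda>y. Poly_Mapping.single (x, y) 1) q) p"
  unfolding ftensor_def lin_ext_def by (simp add: free.scale_sum_right)

lemma ftensor_eq': "ftensor p q = lin_ext (\<lambda>y. lin_ext (\<lambda>x. Poly_Mapping.single (x, y) 1) p) q"
  unfolding ftensor_def lin_ext_def
  by (subst sum.swap) (simp add: free.scale_sum_right mult.commute)

lemma ftensor_single [simp]: "ftensor (Poly_Mapping.single x c) (Poly_Mapping.single y d) = Poly_Mapping.single (x, y) (c * d)"
  by (simp add: ftensor_eq)

lemma ftensor_add_left: "ftensor (p + p') q = ftensor p q + ftensor p' q"
  and ftensor_diff_left: "ftensor (p - p') q = ftensor p q - ftensor p' q"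
  and ftensor_scale_left: "ftensor (fscale c p) q = fscale c (ftensor p q)"
  by (simp_all add: ftensor_eq lin_ext_add lin_ext_diff lin_ext_scale)

lemma ftensor_add_right: "ftensor p (q + q') = ftensor p q + ftensor p q'"
  and ftensor_diff_right: "ftensor p (q - q') = ftensor p q - ftensor p q'"
  and ftensor_scale_right: "ftensor p (fscale c q) = fscale c (ftensor p q)"
  by (simp_all add: ftensor_eq' lin_ext_add lin_ext_diff lin_ext_scale)

lemma subspace_ext_ideal: "free.subspace (ext_ideal scale)"
  by (simp add: ext_ideal_def)

lemma subspace_ext2_null: "free.subspace (ext2_null scale)"
  by (simp add: ext2_null_def)

lemma ext_ideal_mult:
  assumes "a \<in> ext_ideal scale"
  shows "p * a * q \<in> ext_ideal scale"
  using assms unfolding ext_ideal_def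
proof (induct rule: free.span_induct_alt)
  case base
  show ?case by (simp add: free.span_zero)
next
  case (step c x y)
  then obtain p' r q' where "x = p' * r * q'" "r \<in> ext_rels scale" by auto
  then have "p * x * q \<in> {p * r * q | p r q. r \<in> ext_rels scale}"
    by (metis (mono_tags, lifting) mem_Collect_eq mult.assoc)
  with step show ?case
    by (simp add: distrib_left distrib_right fscale_mult_left fscale_mult_right
        free.span_add free.span_scale free.span_base)
qed

lemma coset_eq_iff:
  assumes "free.subspace N"
  shows "p +o N = q +o N \<longleftrightarrow> p - q \<in> N"
proof
  assume "p +o N = q +o N"
  moreover have "p \<in> p +o N"
    using free.subspace_0[OF assms] by (auto simp: elt_set_plus_def intro: bexI[of _ 0])
  ultimately show "p - q \<in> N" by (auto simp: elt_set_plus_def)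
next
  assume *: "p - q \<in> N"
  have "x \<in> p +o N \<longleftrightarrow> x - p \<in> N" for x p by (auto simp: elt_set_plus_def intro: bexI[of _ "x - p"])
  moreover have "x - p \<in> N \<longleftrightarrow> x - q \<in> N" for x
    using free.subspace_add[OF assms _ *, of "x - p"] free.subspace_diff[OF assms _ *, of "x - q"]
    by (auto simp: algebra_simps)
  ultimately show "p +o N = q +o N" by auto
qed

lemma ext_class_eq_iff: "ext_class scale p = ext_class scale q \<longleftrightarrow> p - q \<in> ext_ideal scale"
  unfolding ext_class_def by (rule coset_eq_iff[OF subspace_ext_ideal])

lemma ext2_class_eq_iff: "ext2_class scale p = ext2_class scale q \<longleftrightarrow> p - q \<in> ext2_null scale"
  unfolding ext2_class_def by (rule coset_eq_iff[OF subspace_ext2_null])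

lemma mem_ext_class: "x \<in> ext_class scale p \<longleftrightarrow> x - p \<in> ext_ideal scale"
  unfolding ext_class_def by (auto simp: elt_set_plus_def intro: bexI[of _ "x - p"])

lemma mem_ext2_class: "x \<in> ext2_class scale p \<longleftrightarrow> x - p \<in> ext2_null scale"
  unfolding ext2_class_def by (auto simp: elt_set_plus_def intro: bexI[of _ "x - p"])

lemma ext_mult_class: "ext_mult scale (ext_class scale p) (ext_class scale q) = ext_class scale (p * q)"
proof -
  have "ext_class scale (a * b) = ext_class scale (p * q)"
    if "a \<in> ext_class scale p" "b \<in> ext_class scale q" for a b
  proof -
    have "a * b - p * q = 1 * (a - p) * b + p * (b - q) * 1" by (simp add: algebra_simps)
    then show ?thesis using that
      by (metis ext_class_eq_iff ext_ideal_mult free.subspace_add mem_ext_class subspace_ext_ideal)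
  qed
  moreover have "p \<in> ext_class scale p" for p
    by (simp add: mem_ext_class free.subspace_0 subspace_ext_ideal)
  ultimately show ?thesis unfolding ext_mult_def by blast
qed

lemma wedge_eq: "wedge scale vs = ext_class scale (Poly_Mapping.single (Word vs) 1)"
  by (induct vs)
    (simp_all add: wedge_def ext_mult_class gen_def mult_single plus_word_def
      flip: single_one zero_word_def)

lemma ext2_null_left: "r \<in> ext_ideal scale \<Longrightarrow> ftensor r q \<in> ext2_null scale"
  unfolding ext2_null_def by (rule free.span_base) blast

lemma ext2_null_right: "r \<in> ext_ideal scale \<Longrightarrow> ftensor q r \<in> ext2_null scale"
  unfolding ext2_null_def by (rule free.span_base) blast

lemma ext_tensor_class:
  "ext_tensor scale (ext_class scale p) (ext_class scale q) = ext2_class scale (ftensor p q)"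
proof -
  have "ext2_class scale (ftensor a b) = ext2_class scale (ftensor p q)"
    if "a \<in> ext_class scale p" "b \<in> ext_class scale q" for a b
  proof -
    have "ftensor a b - ftensor p q = ftensor (a - p) b + ftensor p (b - q)"
      by (simp add: ftensor_diff_left ftensor_diff_right)
    then show ?thesis using that
      by (metis ext2_class_eq_iff ext2_null_left ext2_null_right free.subspace_add mem_ext_class
          subspace_ext2_null)
  qed
  moreover have "p \<in> ext_class scale p" for p
    by (simp add: mem_ext_class free.subspace_0 subspace_ext_ideal)
  ultimately show ?thesis unfolding ext_tensor_def by blast
qed

lemma sorted_list_image_strict_mono:
  fixes f :: "'a::linorder \<Rightarrow> 'b::linorder"
  assumes "strict_mono_on A f" "finite A"
  shows "sorted_list_of_set (f ` A) = map f (sorted_list_of_set A)"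
proof (rule sorted_distinct_set_unique)
  have "f x \<le> f y" if "x \<in> A" "y \<in> A" "x \<le> y" for x y
    using strict_mono_onD[OF assms(1), of x y] that by (cases "x = y") (auto simp: less_le)
  then show "sorted (map f (sorted_list_of_set A))"
    unfolding sorted_map using assms(2)
    by (intro sorted_wrt_mono_rel[OF _ sorted_sorted_list_of_set]) auto
  show "distinct (map f (sorted_list_of_set A))"
    using assms by (auto simp: distinct_map strict_mono_on_imp_inj_on)
qed (use assms in auto)

lemma split_perm_permutes:
  assumes "I \<subseteq> {..<n}"
  shows "split_perm n I permutes {..<n}"
proof (rule bij_imp_permutes)
  let ?xs = "sorted_list_of_set I @ sorted_list_of_set ({..<n} - I)"
  have fin: "finite I" using assms finite_subset by blast
  have len: "length ?xs = n"
    using assms fin card_mono[OF _ assms] by (simp add: card_Diff_subset)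
  have "set ?xs = {..<n}" "distinct ?xs" using assms fin by auto
  then have "bij_betw ((!) ?xs) {..<n} {..<n}"
    using bij_betw_nth[of ?xs "{..<n}" "{..<n}"] len by simp
  then show "bij_betw (split_perm n I) {..<n} {..<n}"
    by (rule bij_betw_cong[THEN iffD1, rotated]) (simp add: split_perm_def)
qed (simp add: split_perm_def)

lemma split_sign_swap:
  assumes I: "I \<subseteq> {..<n}" and m: "m \<in> I" "Suc m \<notin> I" "Suc m < n"
  defines "t \<equiv> Transposition.transpose m (Suc m)"
  shows "split_sign n (t ` I) = - split_sign n I"
proof -
  have fin: "finite I" using I finite_subset by blast
  have inv: "t (t k) = k" for k by (simp add: t_def)
  have compl: "{..<n} - t ` I = t ` ({..<n} - I)"
  proof -
    have "t ` {..<n} = {..<n}" using m by (auto simp: t_def transpose_image_eq)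
    then show ?thesis by (metis image_set_diff inj_transpose t_def)
  qed
  have 1: "sorted_list_of_set (t ` I) = map t (sorted_list_of_set I)"
    using m fin by (intro sorted_list_image_strict_mono)
      (auto simp: strict_mono_on_def t_def Transposition.transpose_def)
  have 2: "sorted_list_of_set (t ` ({..<n} - I)) = map t (sorted_list_of_set ({..<n} - I))"
    using m by (intro sorted_list_image_strict_mono)
      (auto simp: strict_mono_on_def t_def Transposition.transpose_def)
  have len: "length (sorted_list_of_set I @ sorted_list_of_set ({..<n} - I)) = n"
    using I fin card_mono[OF _ I] by (simp add: card_Diff_subset)
  have "split_perm n (t ` I) = t \<circ> split_perm n I"
  proof
    fix k
    show "split_perm n (t ` I) k = (t \<circ> split_perm n I) k"
    proof (cases "k < n")
      case True
      then show ?thesis using len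
        by (simp add: split_perm_def compl 1 2 flip: map_append)
    next
      case False
      then show ?thesis using m by (simp add: split_perm_def t_def)
    qed
  qed
  moreover have "permutation (split_perm n I)"
    using split_perm_permutes[OF I] by (auto simp: permutation_permutes)
  ultimately show ?thesis
    by (simp add: split_sign_def t_def sign_compose permutation_swap_id sign_swap_id)
qed

definition term_set :: "nat \<Rightarrow> int \<Rightarrow> int \<Rightarrow> nat set set" where
  "term_set n i j = {I. I \<subseteq> {..<n} \<and> int (card I) = i \<and> int (card ({..<n} - I)) = j}"

definition slice_term :: "'v word \<Rightarrow> 'v word \<Rightarrow> 'v list \<Rightarrow> nat set \<Rightarrow> ('v word \<times> 'v word \<Rightarrow>\<^sub>0 'k::field)" where
  "slice_term a z us I = Poly_Mapping.single (a + Word (nths us I), Word (nths us ({..<length us} - I)) + z)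
      (of_int (split_sign (length us) I))"

lemma lin_ext_slice:
  "lin_ext (\<lambda>(u1, u2). Poly_Mapping.single (a + u1, u2 + z) 1) (slice i j (Word us))
     = (\<Sum>I\<in>term_set (length us) i j. slice_term a z us I)"
  by (simp add: slice_def Let_def term_set_def slice_term_def lin_ext_sum)

lemma lin_ext_slice':
  "lin_ext (\<lambda>(u1, u2). Poly_Mapping.single (u1, u2 + z) 1) (slice i j (Word us))
     = (\<Sum>I\<in>term_set (length us) i j. slice_term 0 z us I)"
  "lin_ext (\<lambda>(u1, u2). Poly_Mapping.single (a + u1, u2) 1) (slice i j (Word us))
     = (\<Sum>I\<in>term_set (length us) i j. slice_term a 0 us I)"
  using lin_ext_slice[of 0 z] lin_ext_slice[of a 0] by simp_all

lemma nths_mid: "nths (xs @ x # ys) I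
   = nths xs I @ (if length xs \<in> I then [x] else []) @ nths ys {k. k + Suc (length xs) \<in> I}"
  by (simp add: nths_append nths_Cons)

lemma slice_term_mid:
  assumes "length xs < n" "n = Suc (length xs + length ys)" "I \<subseteq> {..<n}"
  obtains (l) P Q R where "\<And>x. slice_term a z (xs @ x # ys) I = ftensor (Poly_Mapping.single P 1 * gen x * Poly_Mapping.single Q (1::'k::field)) R"
  | (r) P Q R where "\<And>x. slice_term a z (xs @ x # ys) I = ftensor R (Poly_Mapping.single P 1 * gen x * Poly_Mapping.single Q (1::'k))"
proof (cases "length xs \<in> I")
  have len: "length (xs @ x # ys) = n" for x unfolding assms(2) by simp
  case True
  let ?J = "{..<n} - I"
  let ?s = "of_int (split_sign n I)"
  have "slice_term a z (xs @ x # ys) I =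
     ftensor (Poly_Mapping.single (a + Word (nths xs I)) 1 * gen x * Poly_Mapping.single (Word (nths ys {k. k + Suc (length xs) \<in> I})) 1)
       (Poly_Mapping.single (Word (nths xs ?J @ nths ys {k. k + Suc (length xs) \<in> ?J}) + z) ?s)" for x
    unfolding slice_term_def len[of x] nths_mid gen_def mult_single ftensor_single plus_word_def
    using True by simp
  then show ?thesis by (rule l)
next
  have len: "length (xs @ x # ys) = n" for x unfolding assms(2) by simp
  case False
  let ?J = "{..<n} - I"
  let ?s = "of_int (split_sign n I)"
  have "slice_term a z (xs @ x # ys) I =
     ftensor (Poly_Mapping.single (a + Word (nths xs I @ nths ys {k. k + Suc (length xs) \<in> I})) ?s)
      (Poly_Mapping.single (Word (nths xs ?J)) 1 * gen x * Poly_Mapping.single (Word (nths ys {k. k + Suc (length xs) \<in> ?J}) + z) 1)" for x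
    unfolding slice_term_def len[of x] nths_mid gen_def mult_single ftensor_single plus_word_def
    using False assms(1) by simp
  then show ?thesis by (rule r)
qed

lemma rel_in_ideal: "r \<in> ext_rels scale \<Longrightarrow> p * r * q \<in> ext_ideal scale"
  unfolding ext_ideal_def by (rule free.span_base) blast

lemma slice_add:
  fixes scale :: "'k::field \<Rightarrow> 'v::ab_group_add \<Rightarrow> 'v"
  assumes "I \<subseteq> {..<n}" "n = Suc (length xs + length ys)"
  shows "slice_term a z (xs @ (x + y) # ys) I - slice_term a z (xs @ x # ys) I
       - slice_term a z (xs @ y # ys) I \<in> ext2_null scale"
proof -
  have "gen (x + y) - gen x - gen y \<in> ext_rels scale" by (auto simp: ext_rels_def)
  note * = rel_in_ideal[OF this]
  have "length xs < n" using assms by simp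
  then consider (l) P Q R where "\<And>x. slice_term a z (xs @ x # ys) I = ftensor (Poly_Mapping.single P 1 * gen x * Poly_Mapping.single Q (1::'k)) R"
  | (r) P Q R where "\<And>x. slice_term a z (xs @ x # ys) I = ftensor R (Poly_Mapping.single P 1 * gen x * Poly_Mapping.single Q (1::'k))"
    using assms(2) assms(1) by (rule slice_term_mid[of _ _ _ _ a z]) blast+
  then show ?thesis
  proof cases
    case (l P Q R)
    show ?thesis unfolding l using ext2_null_left[OF *, of "Poly_Mapping.single P 1" "Poly_Mapping.single Q 1" R]
      by (simp add: right_diff_distrib left_diff_distrib ftensor_diff_left)
  next
    case (r P Q R)
    show ?thesis unfolding r using ext2_null_right[OF *, of R "Poly_Mapping.single P 1" "Poly_Mapping.single Q 1"]
      by (simp add: right_diff_distrib left_diff_distrib ftensor_diff_right)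
  qed
qed

lemma slice_scale:
  fixes scale :: "'k::field \<Rightarrow> 'v::ab_group_add \<Rightarrow> 'v"
  assumes "I \<subseteq> {..<n}" "n = Suc (length xs + length ys)"
  shows "slice_term a z (xs @ (scale c x) # ys) I - fscale c (slice_term a z (xs @ x # ys) I)
     \<in> ext2_null scale"
proof -
  have "gen (scale c x) - fscale c (gen x) \<in> ext_rels scale" by (auto simp: ext_rels_def)
  note * = rel_in_ideal[OF this]
  have "length xs < n" using assms by simp
  then consider (l) P Q R where "\<And>x. slice_term a z (xs @ x # ys) I = ftensor (Poly_Mapping.single P 1 * gen x * Poly_Mapping.single Q (1::'k)) R"
  | (r) P Q R where "\<And>x. slice_term a z (xs @ x # ys) I = ftensor R (Poly_Mapping.single P 1 * gen x * Poly_Mapping.single Q (1::'k))"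
    using assms(2) assms(1) by (rule slice_term_mid[of _ _ _ _ a z]) blast+
  then show ?thesis
  proof cases
    case (l P Q R)
    show ?thesis unfolding l using ext2_null_left[OF *, of "Poly_Mapping.single P 1" "Poly_Mapping.single Q 1" R]
      by (simp add: right_diff_distrib left_diff_distrib ftensor_diff_left
          fscale_mult_left fscale_mult_right ftensor_scale_left)
  next
    case (r P Q R)
    show ?thesis unfolding r using ext2_null_right[OF *, of R "Poly_Mapping.single P 1" "Poly_Mapping.single Q 1"]
      by (simp add: right_diff_distrib left_diff_distrib ftensor_diff_right
          fscale_mult_left fscale_mult_right ftensor_scale_right)
  qed
qed

lemma word_repeat_in_ideal: "Poly_Mapping.single (Word (xs @ x # x # ys)) c \<in> ext_ideal scale"
proof -
  have "gen x * gen x \<in> ext_rels scale" by (auto simp: ext_rels_def)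
  from rel_in_ideal[OF this, of "Poly_Mapping.single (Word xs) c" "Poly_Mapping.single (Word ys) 1"] show ?thesis
    by (simp add: gen_def mult_single plus_word_def)
qed

lemma slice_repeat:
  fixes scale :: "'k::field \<Rightarrow> 'v::ab_group_add \<Rightarrow> 'v"
  assumes n: "n = Suc (Suc (length xs + length ys))"
  shows "(\<Sum>I\<in>term_set n i j. slice_term a z (xs @ x # x # ys) I :: _ \<Rightarrow>\<^sub>0 'k) \<in> ext2_null scale"
proof -
  let ?m = "length xs"
  let ?t = "Transposition.transpose ?m (Suc ?m)"
  let ?T = "slice_term a z (xs @ x # x # ys) :: nat set \<Rightarrow> (_ \<Rightarrow>\<^sub>0 'k)"
  define X where "X = {I \<in> term_set n i j. ?m \<in> I \<and> Suc ?m \<notin> I}"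
  define Y where "Y = {I \<in> term_set n i j. ?m \<notin> I \<and> Suc ?m \<in> I}"
  define Z where "Z = {I \<in> term_set n i j. ?m \<in> I \<longleftrightarrow> Suc ?m \<in> I}"
  have fin: "finite (term_set n i j)" by (auto simp: term_set_def)
  have split: "term_set n i j = (X \<union> Y) \<union> Z" "(X \<union> Y) \<inter> Z = {}" "X \<inter> Y = {}"
    by (auto simp: X_def Y_def Z_def)
  have fins: "finite X" "finite Y" "finite Z" using fin by (auto simp: X_def Y_def Z_def)
  have nths2: "nths (xs @ x # x # ys) I = nths xs I @ (if ?m \<in> I then [x] else []) @
     (if Suc ?m \<in> I then [x] else []) @ nths ys {k. k + Suc (Suc ?m) \<in> I}" for I
    by (simp add: nths_mid nths_Cons)
  have t_img: "?t ` {..<n} = {..<n}" using n by (auto simp: transpose_image_eq)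
  have t_in: "k \<in> ?t ` I \<longleftrightarrow> ?t k \<in> I" for k I using inj_image_mem_iff[OF inj_transpose[of ?m "Suc ?m"], of "?t k" I] by simp
  have t_term: "?t ` I \<in> term_set n i j" if "I \<in> term_set n i j" for I
  proof -
    have "{..<n} - ?t ` I = ?t ` ({..<n} - I)" by (simp only: t_img image_set_diff[OF inj_transpose])
    moreover have "?t ` I \<subseteq> {..<n}"
      using that image_mono[of I "{..<n}" ?t] t_img by (simp add: term_set_def)
    ultimately show ?thesis using that
      by (simp add: term_set_def card_image inj_on_transpose)
  qed
  have "bij_betw ((`) ?t) X Y"
    by (rule bij_betw_byWitness[where f' = "(`) ?t"])
      (simp_all add: X_def Y_def t_term t_in image_image image_subset_iff)
  then have "sum ?T Y = (\<Sum>I\<in>X. ?T (?t ` I))" by (simp add: sum.reindex_bij_betw)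
  also have "\<dots> = (\<Sum>I\<in>X. - ?T I)"
  proof (rule sum.cong[OF refl])
    fix I assume I: "I \<in> X"
    then have sub: "I \<subseteq> {..<n}" "?m \<in> I" "Suc ?m \<notin> I" by (auto simp: X_def term_set_def)
    have sgn: "split_sign n (?t ` I) = - split_sign n I"
      using split_sign_swap[of I n ?m] sub n by simp
    have lo: "nths xs (?t ` K) = nths xs K" for K
      unfolding nths_def by (rule arg_cong[where f = "map fst"], rule filter_cong)
        (auto simp: t_in set_zip)
    have hi: "{k. k + Suc (Suc ?m) \<in> ?t ` K} = {k. k + Suc (Suc ?m) \<in> K}" for K
      by (auto simp: t_in)
    have c: "{..<n} - ?t ` I = ?t ` ({..<n} - I)" by (simp only: t_img image_set_diff[OF inj_transpose])
    have sw: "nths (xs @ x # x # ys) (?t ` K) = nths (xs @ x # x # ys) K"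
      if "(?m \<in> K) \<noteq> (Suc ?m \<in> K)" for K
    proof -
      have "?m \<in> ?t ` K \<longleftrightarrow> Suc ?m \<in> K" "Suc ?m \<in> ?t ` K \<longleftrightarrow> ?m \<in> K"
        by (simp_all add: t_in)
      then show ?thesis using that unfolding nths2 lo hi by auto
    qed
    have 1: "nths (xs @ x # x # ys) (?t ` I) = nths (xs @ x # x # ys) I"
      using sub by (intro sw) simp
    have 2: "nths (xs @ x # x # ys) ({..<n} - ?t ` I) = nths (xs @ x # x # ys) ({..<n} - I)"
      unfolding c using sub n by (intro sw) simp
    have len: "length (xs @ x # x # ys) = n" unfolding n by simp
    show "?T (?t ` I) = - ?T I"
      unfolding slice_term_def len 1 2 sgn by (simp add: single_uminus)
  qed
  finally have "sum ?T X + sum ?T Y = 0" by (simp add: sum_negf)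
  moreover have "sum ?T Z \<in> ext2_null scale"
  proof (rule free.subspace_sum[OF subspace_ext2_null])
    fix I assume "I \<in> Z"
    then have sub: "I \<subseteq> {..<n}" "?m \<in> I \<longleftrightarrow> Suc ?m \<in> I" by (auto simp: Z_def term_set_def)
    have len: "length (xs @ x # x # ys) = n" unfolding n by simp
    show "?T I \<in> ext2_null scale"
    proof (cases "?m \<in> I")
      case True
      then have "?T I = ftensor
         (Poly_Mapping.single (Word ((letters a @ nths xs I) @ x # x # nths ys {k. k + Suc (Suc ?m) \<in> I})) 1)
         (Poly_Mapping.single (Word (nths (xs @ x # x # ys) ({..<n} - I)) + z) (of_int (split_sign n I)))"
        unfolding slice_term_def len using sub by (simp add: nths2 plus_word_def)
      then show ?thesis using ext2_null_left word_repeat_in_ideal by metis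
    next
      case False
      let ?J = "{..<n} - I"
      have "?m \<in> ?J" "Suc ?m \<in> ?J" using False sub n by auto
      then have "?T I = ftensor
         (Poly_Mapping.single (a + Word (nths (xs @ x # x # ys) I)) (of_int (split_sign n I)))
         (Poly_Mapping.single (Word (nths xs ?J @ x # x # (nths ys {k. k + Suc (Suc ?m) \<in> ?J} @ letters z))) 1)"
        unfolding slice_term_def len by (subst (2) nths2) (simp add: plus_word_def)
      then show ?thesis using ext2_null_right word_repeat_in_ideal by metis
    qed
  qed
  ultimately show ?thesis
    using fins split by (simp add: sum.union_disjoint)
qed


lemma word_diamond21_eq:
  "word_diamond21 h (Word us, w)
     = (\<Sum>I\<in>term_set (length us) (int (length us) - int h) (int h). slice_term 0 w us I)"
  by (simp add: word_diamond21_def lin_ext_slice')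

lemma word_diamond12_eq:
  "word_diamond12 h (u, Word ws)
     = (\<Sum>I\<in>term_set (length ws) (int h) (int (length ws) - int h). slice_term u 0 ws I)"
  by (simp add: word_diamond12_def lin_ext_slice')

lemma slice_ideal_aux:
  fixes scale :: "'k::field \<Rightarrow> 'v::ab_group_add \<Rightarrow> 'v"
    and G :: "'v word \<Rightarrow> ('v word \<times> 'v word \<Rightarrow>\<^sub>0 'k)"
  assumes G: "\<And>us. G (Word us) = (\<Sum>I\<in>term_set (length us) (i (length us)) (j (length us)). slice_term a z us I)"
    and "r \<in> ext_ideal scale"
  shows "lin_ext G r \<in> ext2_null scale"
proof -
  note sub = free.subspace_add[OF subspace_ext2_null] free.subspace_scale[OF subspace_ext2_null]
    free.subspace_sum[OF subspace_ext2_null] free.subspace_0[OF subspace_ext2_null]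
  have word: "lin_ext G (Poly_Mapping.single u 1 * r * Poly_Mapping.single w 1) \<in> ext2_null scale" if "r \<in> ext_rels scale" for r u w
  proof -
    obtain xs ys where uw: "u = Word xs" "w = Word ys" by (metis word.exhaust)
    let ?n = "Suc (length xs + length ys)"
    consider (add) x y where "r = gen (x + y) - gen x - gen y"
      | (scale) c x where "r = gen (scale c x) - fscale c (gen x)"
      | (rep) x where "r = gen x * gen x"
      using \<open>r \<in> ext_rels scale\<close> by (auto simp: ext_rels_def)
    then show ?thesis
    proof cases
      case add
      have "lin_ext G (Poly_Mapping.single u 1 * r * Poly_Mapping.single w 1) =
        G (Word (xs @ (x + y) # ys)) - G (Word (xs @ x # ys)) - G (Word (xs @ y # ys))"
        unfolding add uw
        by (simp add: gen_def left_diff_distrib right_diff_distrib mult_single plus_word_def lin_ext_diff)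
      also have "\<dots> = (\<Sum>I\<in>term_set ?n (i ?n) (j ?n). slice_term a z (xs @ (x + y) # ys) I
          - slice_term a z (xs @ x # ys) I - slice_term a z (xs @ y # ys) I)"
        by (simp add: G sum_subtractf)
      also have "\<dots> \<in> ext2_null scale"
        by (intro sub slice_add[of _ ?n]) (auto simp: term_set_def)
      finally show ?thesis .
    next
      case scale
      have "lin_ext G (Poly_Mapping.single u 1 * r * Poly_Mapping.single w 1) =
        G (Word (xs @ scale c x # ys)) - fscale c (G (Word (xs @ x # ys)))"
        unfolding scale uw
        by (simp add: gen_def left_diff_distrib right_diff_distrib mult_single plus_word_def lin_ext_diff)
      also have "\<dots> = (\<Sum>I\<in>term_set ?n (i ?n) (j ?n). slice_term a z (xs @ scale c x # ys) I
          - fscale c (slice_term a z (xs @ x # ys) I))"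
        by (simp add: G sum_subtractf free.scale_sum_right)
      also have "\<dots> \<in> ext2_null scale"
        by (intro sub slice_scale[of _ ?n]) (auto simp: term_set_def)
      finally show ?thesis .
    next
      case rep
      have "lin_ext G (Poly_Mapping.single u 1 * r * Poly_Mapping.single w 1) = G (Word (xs @ x # x # ys))"
        unfolding rep uw by (simp add: gen_def mult_single plus_word_def)
      then show ?thesis by (simp add: G slice_repeat)
    qed
  qed
  have gens: "lin_ext G (p * r * q) \<in> ext2_null scale" if "r \<in> ext_rels scale" for p r q
  proof (induct p rule: free_induct)
    case (1 u c)
    show ?case
    proof (induct q rule: free_induct)
      case (1 w d)
      have "Poly_Mapping.single u c * r * Poly_Mapping.single w d = fscale c (fscale d (Poly_Mapping.single u 1 * r * Poly_Mapping.single w 1))"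
        by (metis fscale_mult_left fscale_mult_right fscale_single mult.right_neutral)
      then show ?case using word[OF that] by (simp add: lin_ext_scale sub)
    qed (simp add: distrib_left lin_ext_add sub)
  qed (simp add: distrib_right lin_ext_add sub)
  show ?thesis
    using assms(2) unfolding ext_ideal_def
    by (induct rule: free.span_induct_alt) (auto simp: lin_ext_add lin_ext_scale intro!: sub gens)
qed

lemma diamond21_null:
  assumes "t \<in> ext2_null scale"
  shows "lin_ext (word_diamond21 h) t \<in> ext2_null scale"
proof -
  note sub = free.subspace_add[OF subspace_ext2_null] free.subspace_scale[OF subspace_ext2_null]
    free.subspace_sum[OF subspace_ext2_null] free.subspace_0[OF subspace_ext2_null]
  have 1: "lin_ext (word_diamond21 h) (ftensor r q) \<in> ext2_null scale" if "r \<in> ext_ideal scale" for r q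
  proof (induct q rule: free_induct)
    case (1 w d)
    have "lin_ext (word_diamond21 h) (ftensor p (Poly_Mapping.single w d))
        = fscale d (lin_ext (\<lambda>u. word_diamond21 h (u, w)) p)" for p
      by (induct p rule: free_induct)
        (simp_all add: ftensor_add_left lin_ext_add free.scale_right_distrib mult.commute)
    then show ?case
      using slice_ideal_aux[where G = "\<lambda>u. word_diamond21 h (u, w)" and i = "\<lambda>n. int n - int h"
          and j = "\<lambda>n. int h", OF word_diamond21_eq that] by (simp add: sub)
  qed (simp add: ftensor_add_right lin_ext_add sub)
  have 2: "lin_ext (word_diamond21 h) (ftensor q r) \<in> ext2_null scale" if "r \<in> ext_ideal scale" for r q
  proof (induct q rule: free_induct)
    case (1 u d)
    obtain us where us: "u = Word us" by (metis word.exhaust)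
    let ?n = "length us"
    have "lin_ext (word_diamond21 h) (ftensor (Poly_Mapping.single u d) p)
        = (\<Sum>I\<in>term_set ?n (int ?n - int h) (int h).
            ftensor (Poly_Mapping.single (Word (nths us I)) (d * of_int (split_sign ?n I)))
              (Poly_Mapping.single (Word (nths us ({..<?n} - I))) 1 * p * 1))" for p
      by (induct p rule: free_induct)
        (simp_all add: us word_diamond21_eq ftensor_add_right lin_ext_add distrib_left sum.distrib
          slice_term_def mult_single free.scale_sum_right mult_ac)
    then show ?case
      using that by (auto intro!: sub ext2_null_right ext_ideal_mult simp del: mult_1_right)
  qed (simp add: ftensor_add_left lin_ext_add sub)
  show ?thesis
    using assms[unfolded ext2_null_def]
    by (induct rule: free.span_induct_alt)
      (auto simp: lin_ext_add lin_ext_scale intro: sub 1 2)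
qed

lemma diamond12_null:
  assumes "t \<in> ext2_null scale"
  shows "lin_ext (word_diamond12 h) t \<in> ext2_null scale"
proof -
  note sub = free.subspace_add[OF subspace_ext2_null] free.subspace_scale[OF subspace_ext2_null]
    free.subspace_sum[OF subspace_ext2_null] free.subspace_0[OF subspace_ext2_null]
  have 1: "lin_ext (word_diamond12 h) (ftensor q r) \<in> ext2_null scale" if "r \<in> ext_ideal scale" for r q
  proof (induct q rule: free_induct)
    case (1 u d)
    have "lin_ext (word_diamond12 h) (ftensor (Poly_Mapping.single u d) p)
        = fscale d (lin_ext (\<lambda>w. word_diamond12 h (u, w)) p)" for p
      by (induct p rule: free_induct)
        (simp_all add: ftensor_add_right lin_ext_add free.scale_right_distrib mult.commute)
    then show ?case
      using slice_ideal_aux[where G = "\<lambda>w. word_diamond12 h (u, w)" and i = "\<lambda>n. int h"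
          and j = "\<lambda>n. int n - int h", OF word_diamond12_eq that] by (simp add: sub)
  qed (simp add: ftensor_add_left lin_ext_add sub)
  have 2: "lin_ext (word_diamond12 h) (ftensor r q) \<in> ext2_null scale" if "r \<in> ext_ideal scale" for r q
  proof (induct q rule: free_induct)
    case (1 w d)
    obtain ws where ws: "w = Word ws" by (metis word.exhaust)
    let ?n = "length ws"
    have "lin_ext (word_diamond12 h) (ftensor p (Poly_Mapping.single w d))
        = (\<Sum>I\<in>term_set ?n (int h) (int ?n - int h).
            ftensor (1 * p * Poly_Mapping.single (Word (nths ws I)) 1)
              (Poly_Mapping.single (Word (nths ws ({..<?n} - I))) (d * of_int (split_sign ?n I))))" for p
      by (induct p rule: free_induct)
        (simp_all add: ws word_diamond12_eq ftensor_add_left lin_ext_add distrib_right sum.distrib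
          slice_term_def mult_single free.scale_sum_right mult_ac)
    then show ?case
      using that by (auto intro!: sub ext2_null_left ext_ideal_mult simp del: mult_1_left)
  qed (simp add: ftensor_add_right lin_ext_add sub)
  show ?thesis
    using assms[unfolded ext2_null_def]
    by (induct rule: free.span_induct_alt)
      (auto simp: lin_ext_add lin_ext_scale intro: sub 1 2)
qed

lemma coset_map:
  assumes "\<And>t. t \<in> ext2_null scale \<Longrightarrow> lin_ext F t \<in> ext2_null scale"
  shows "(\<Union>x\<in>ext2_class scale t. ext2_class scale (lin_ext F x)) = ext2_class scale (lin_ext F t)"
proof -
  have "ext2_class scale (lin_ext F x) = ext2_class scale (lin_ext F t)" if "x \<in> ext2_class scale t" for x
    using that assms[of "x - t"] by (simp add: ext2_class_eq_iff mem_ext2_class lin_ext_diff)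
  moreover have "t \<in> ext2_class scale t"
    by (simp add: mem_ext2_class free.subspace_0 subspace_ext2_null)
  ultimately show ?thesis by blast
qed

lemma diamond21_class:
  "diamond21 scale h (ext2_class scale t) = ext2_class scale (lin_ext (word_diamond21 h) t)"
  unfolding diamond21_def by (intro coset_map diamond21_null)

lemma diamond12_class:
  "diamond12 scale h (ext2_class scale t) = ext2_class scale (lin_ext (word_diamond12 h) t)"
  unfolding diamond12_def by (intro coset_map diamond12_null)

text \<open>
  The defining formulas of the geometric products, for arbitrary products of vectors.
\<close>

lemma diamond21_wedge:
  "diamond21 scale h (ext_tensor scale (wedge scale us) (wedge scale ws)) = ext2_class scale
     (\<Sum>I | I \<subseteq> {..<length us} \<and> card ({..<length us} - I) = h.
        Poly_Mapping.single (Word (nths us I), Word (nths us ({..<length us} - I) @ ws))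
          (of_int (split_sign (length us) I)))"
proof -
  have "{I. I \<subseteq> {..<length us} \<and> card ({..<length us} - I) = h}
      = term_set (length us) (int (length us) - int h) (int h)"
    using card_mono[of "{..<length us}"]
    by (fastforce simp: term_set_def card_Diff_subset finite_subset)
  then show ?thesis
    by (simp add: wedge_eq ext_tensor_class diamond21_class word_diamond21_eq slice_term_def
        plus_word_def zero_word_def)
qed

lemma diamond12_wedge:
  "diamond12 scale h (ext_tensor scale (wedge scale us) (wedge scale ws)) = ext2_class scale
     (\<Sum>I | I \<subseteq> {..<length ws} \<and> card I = h.
        Poly_Mapping.single (Word (us @ nths ws I), Word (nths ws ({..<length ws} - I)))
          (of_int (split_sign (length ws) I)))"
proof -
  have "{I. I \<subseteq> {..<length ws} \<and> card I = h}
      = term_set (length ws) (int h) (int (length ws) - int h)"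
    using card_mono[of "{..<length ws}"]
    by (fastforce simp: term_set_def card_Diff_subset finite_subset)
  then show ?thesis
    by (simp add: wedge_eq ext_tensor_class diamond12_class word_diamond12_eq slice_term_def
        plus_word_def zero_word_def)
qed

end

theory Submission
  imports Defs
begin

text \<open>
  The whole statement is read off from adapted bases. Choose a basis \<open>e\<close> of
  \<open>\<langle>A\<rangle> \<inter> \<langle>B\<rangle>\<close>, where \<open>\<langle>A\<rangle>\<close> is the space of \<open>A\<close>, and extend it to a basis \<open>e f\<close> of \<open>\<langle>A\<rangle>\<close> and to a basis
  \<open>e g\<close> of \<open>\<langle>B\<rangle>\<close>. Then \<open>f e g\<close> is a basis of \<open>\<langle>A\<rangle> + \<langle>B\<rangle>\<close>, and up to nonzero scalars \<open>A\<close> and \<open>B\<close> are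
  the products of the lists \<open>e f\<close> and \<open>e g\<close>; moreover \<open>p\<close> is the length of \<open>f\<close> and \<open>p'\<close> that
  of \<open>g\<close>. The geometric product \<open>\<diamond>\<^sub>2\<^sub>1\<close> of height \<open>h\<close> is a signed sum over the ways to move \<open>h\<close> of the
  letters of \<open>e f\<close> in front of \<open>e g\<close>. A term that moves a letter of \<open>e\<close> contains that letter twice
  in its second factor, so it vanishes. If \<open>h > p\<close>, every term moves a letter of \<open>e\<close>; if \<open>h = p\<close>,
  the only term that does not is the one that moves exactly \<open>f\<close>, and it equals
  \<open>e \<otimes> f e g\<close> up to sign. The product \<open>\<diamond>\<^sub>1\<^sub>2\<close> is treated alike, with \<open>g\<close> moved behind \<open>e f\<close>; these are
  \<open>word_diamond21_common_prefix\<close> and \<open>word_diamond12_common_prefix\<close>.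

  To know that the surviving factors are extensors one needs that a product of linearly
  independent vectors is nonzero in \<open>\<Lambda>(V)\<close>. This rests on contraction with a linear form, which
  descends to \<open>\<Lambda>(V)\<close> (\<open>contract_in_ideal\<close>): contracting with the first dual basis vector removes
  the first factor, and after all factors are gone the product has become the unit, which is not
  in the ideal. As a consequence (\<open>gen_annihilator_monom\<close>) the space of an extensor is its
  annihilator \<open>{v. v A = 0}\<close>, and hence depends only on \<open>A\<close>.

  The passage to adapted bases is a Steinitz exchange (\<open>exchange_letter\<close>, \<open>exchange_list\<close>) that
  keeps track of the product: each step changes it by a nonzero scalar only.
\<close>

section \<open>Calculations modulo the ideal of the exterior algebra\<close>
abbreviation monom :: "'v list \<Rightarrow> ('v word \<Rightarrow>\<^sub>0 'k::field)" where
  "monom vs \<equiv> Poly_Mapping.single (Word vs) 1"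

lemma monom_append: "monom (xs @ ys) = (monom xs * monom ys :: 'v word \<Rightarrow>\<^sub>0 'k::field)"
  by (simp add: mult_single plus_word_def)

lemma monom_Cons: "monom (x # xs) = (gen x * monom xs :: 'v word \<Rightarrow>\<^sub>0 'k::field)"
  by (simp add: mult_single plus_word_def gen_def)

lemma monom_Nil: "monom [] = (1 :: 'v word \<Rightarrow>\<^sub>0 'k::field)"
  by (simp flip: single_one zero_word_def)

lemma single_eq_fscale_monom: "Poly_Mapping.single (Word vs) c = fscale c (monom vs)"
  by simp

lemmas ext_ideal_add = free.subspace_add[OF subspace_ext_ideal]
lemmas ext_ideal_diff = free.subspace_diff[OF subspace_ext_ideal]
lemmas ext_ideal_scale = free.subspace_scale[OF subspace_ext_ideal]
lemmas ext_ideal_zero = free.subspace_0[OF subspace_ext_ideal]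
lemmas ext_ideal_neg = free.subspace_neg[OF subspace_ext_ideal]
lemmas ext_ideal_closed = ext_ideal_add ext_ideal_diff ext_ideal_scale ext_ideal_zero ext_ideal_neg

lemma ext_ideal_mult_left: "a \<in> ext_ideal scale \<Longrightarrow> p * a \<in> ext_ideal scale"
  using ext_ideal_mult[of a scale p 1] by simp

lemma ext_ideal_mult_right: "a \<in> ext_ideal scale \<Longrightarrow> a * q \<in> ext_ideal scale"
  using ext_ideal_mult[of a scale 1 q] by simp

lemma fscale_in_ideal_iff: "c \<noteq> 0 \<Longrightarrow> fscale c p \<in> ext_ideal scale \<longleftrightarrow> p \<in> ext_ideal scale"
  using ext_ideal_scale[of p scale c] ext_ideal_scale[of "fscale c p" scale "inverse c"] by auto

lemma ext_ideal_cong: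
  assumes "ext_class scale p = ext_class scale q"
  shows "p \<in> ext_ideal scale \<longleftrightarrow> q \<in> ext_ideal scale"
proof -
  have "r \<in> ext_ideal scale \<longleftrightarrow> ext_class scale r = ext_class scale 0" for r
    by (simp add: ext_class_eq_iff)
  then show ?thesis using assms by simp
qed

lemma ext_rels_in_ideal: "r \<in> ext_rels scale \<Longrightarrow> r \<in> ext_ideal scale"
  using rel_in_ideal[of r scale 1 1] by simp

lemma gen_add_in_ideal: "gen (x + y) - gen x - gen y \<in> ext_ideal scale"
  and gen_scale_in_ideal: "gen (scale c x) - fscale c (gen x) \<in> ext_ideal scale"
  and gen_square_in_ideal: "gen x * gen x \<in> ext_ideal scale"
  by (intro ext_rels_in_ideal; auto simp: ext_rels_def)+

text \<open>
  Polarisation of the relation \<open>x x = 0\<close>: expand \<open>(x + y)(x + y)\<close>. The error terms come from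
  \<open>gen (x + y)\<close> being \<open>gen x + gen y\<close> only modulo the ideal.
\<close>
lemma gen_anticommute_in_ideal:
  "gen x * gen y + gen y * gen x \<in> ext_ideal (scale :: 'k::field \<Rightarrow> 'v::ab_group_add \<Rightarrow> 'v)"
proof -
  let ?r = "gen (x + y) - gen x - gen y :: 'v word \<Rightarrow>\<^sub>0 'k"
  have "gen x * gen y + gen y * gen x =
     gen (x + y) * gen (x + y) - gen x * gen x - gen y * gen y
     - ?r * gen (x + y) - (gen x + gen y) * ?r"
    by (simp add: algebra_simps)
  also have "\<dots> \<in> ext_ideal scale"
    by (intro ext_ideal_closed gen_square_in_ideal ext_ideal_mult_left ext_ideal_mult_right gen_add_in_ideal)
  finally show ?thesis .
qed

text \<open>
  Anticommutation moves \<open>x\<close> to the right until it meets its second occurrence.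
\<close>
lemma gen_monom_in_ideal:
  assumes "x \<in> set ws"
  shows "gen x * monom ws \<in> ext_ideal (scale :: 'k::field \<Rightarrow> 'v::ab_group_add \<Rightarrow> 'v)"
  using assms
proof (induct ws)
  case (Cons y ws)
  show ?case
  proof (cases "x = y")
    case True
    then show ?thesis
      by (simp add: monom_Cons ext_ideal_mult_right gen_square_in_ideal flip: mult.assoc)
  next
    case False
    then have "gen x * monom ws \<in> ext_ideal scale" using Cons by simp
    moreover have "gen x * monom (y # ws) =
        (gen x * gen y + gen y * gen x) * monom ws - gen y * (gen x * monom ws :: 'v word \<Rightarrow>\<^sub>0 'k)"
      by (simp add: monom_Cons algebra_simps)
    ultimately show ?thesis
      by (metis ext_ideal_diff ext_ideal_mult_left ext_ideal_mult_right gen_anticommute_in_ideal)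
  qed
qed simp

lemma monom_repeat_in_ideal:
  assumes "x \<in> set us" "x \<in> set ws"
  shows "monom (us @ ws) \<in> ext_ideal (scale :: 'k::field \<Rightarrow> 'v::ab_group_add \<Rightarrow> 'v)"
proof -
  obtain u1 u2 where us: "us = u1 @ x # u2" using assms(1) by (meson split_list)
  have "monom (us @ ws) = monom u1 * (gen x * monom (u2 @ ws) :: 'v word \<Rightarrow>\<^sub>0 'k)"
    by (simp add: us monom_append monom_Cons mult.assoc)
  then show ?thesis
    using assms(2) by (simp only:) (intro ext_ideal_mult_left gen_monom_in_ideal, simp)
qed

section \<open>Contraction with a linear form\<close>

text \<open>
  Contraction (the interior product) with \<open>f\<close> is the antiderivation of the free algebra that sends
  the generator of \<open>x\<close> to the scalar \<open>f x\<close>.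
\<close>
primrec contract_letters :: "('v \<Rightarrow> 'k) \<Rightarrow> 'v list \<Rightarrow> ('v word \<Rightarrow>\<^sub>0 'k::field)" where
  "contract_letters f [] = 0"
| "contract_letters f (x # xs) = fscale (f x) (monom xs) - gen x * contract_letters f xs"

definition contract :: "('v \<Rightarrow> 'k) \<Rightarrow> ('v word \<Rightarrow>\<^sub>0 'k::field) \<Rightarrow> ('v word \<Rightarrow>\<^sub>0 'k)" where
  "contract f = lin_ext (\<lambda>u. contract_letters f (letters u))"

lemma contract_monom: "contract f (monom xs) = contract_letters f xs"
  by (simp add: contract_def)

lemma contract_add: "contract f (p + q) = contract f p + contract f q"
  and contract_diff: "contract f (p - q) = contract f p - contract f q"
  and contract_scale: "contract f (fscale c p) = fscale c (contract f p)"
  and contract_zero: "contract f 0 = 0"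
  by (simp_all add: contract_def lin_ext_add lin_ext_diff lin_ext_scale)

lemma contract_gen_mult: "contract f (gen x * q) = fscale (f x) q - gen x * contract f q"
proof (induct q rule: free_induct)
  case (1 u c)
  obtain us where u: "Poly_Mapping.single u c = fscale c (monom us)"
    by (metis word.exhaust single_eq_fscale_monom)
  show ?case unfolding u fscale_mult_right contract_scale monom_Cons[symmetric] contract_monom
    by (simp only: contract_letters.simps free.scale_right_diff_distrib free.scale_left_commute)
next
  case (2 p q)
  then show ?case
    by (simp add: distrib_left contract_add free.scale_right_distrib)
qed

text \<open>
  Contraction passes to the exterior algebra. The antiderivation rule kills the scalar parts of
  each defining relation \<open>r\<close>: for the first two by linearity of \<open>f\<close>, for \<open>x x\<close> because the two
  terms \<open>f x * x\<close> cancel. What remains of the contraction of \<open>r q\<close> is \<open>r\<close> times the contraction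
  of \<open>q\<close>, up to sign, and this is in the ideal.
\<close>
lemma contract_in_ideal:
  fixes f :: "'v::ab_group_add \<Rightarrow> 'k::field"
  assumes add: "\<And>x y. f (x + y) = f x + f y" and homog: "\<And>c x. f (scale c x) = c * f x"
    and q: "q \<in> ext_ideal scale"
  shows "contract f q \<in> ext_ideal scale"
proof -
  have rel: "contract f (r * q) \<in> ext_ideal scale" if r: "r \<in> ext_rels scale" for r q
  proof -
    consider (a) x y where "r = gen (x + y) - gen x - gen y"
      | (s) c x where "r = gen (scale c x) - fscale c (gen x)"
      | (x) x where "r = gen x * gen x"
      using r by (auto simp: ext_rels_def)
    then have "contract f (r * q) = r * contract f q \<or> contract f (r * q) = - (r * contract f q)"
    proof cases
      case (a x y)
      then show ?thesis
        by (simp add: left_diff_distrib contract_diff contract_gen_mult add free.scale_left_distrib)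
    next
      case (s c x)
      then show ?thesis
        by (simp add: left_diff_distrib contract_diff contract_gen_mult homog fscale_mult_left
            contract_scale free.scale_right_diff_distrib)
    next
      case (x x)
      then show ?thesis
        by (simp add: mult.assoc contract_gen_mult right_diff_distrib fscale_mult_right)
    qed
    moreover have "r * contract f q \<in> ext_ideal scale"
      using r by (intro ext_ideal_mult_right ext_rels_in_ideal)
    ultimately show ?thesis using ext_ideal_neg by metis
  qed
  have word: "contract f (monom us * (r * q)) \<in> ext_ideal scale" if r: "r \<in> ext_rels scale" for us r q
  proof (induct us)
    case Nil
    show ?case unfolding monom_Nil mult_1_left by (rule rel[OF r])
  next
    case (Cons u us)
    show ?case unfolding monom_Cons mult.assoc contract_gen_mult
      using r by (intro ext_ideal_diff ext_ideal_scale ext_ideal_mult_left[OF Cons] ext_ideal_mult_left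
          ext_ideal_mult_right ext_rels_in_ideal)
  qed
  have gens: "contract f (p * r * q) \<in> ext_ideal scale" if r: "r \<in> ext_rels scale" for p r q
  proof (induct p rule: free_induct)
    case (1 u c)
    obtain us where u: "Poly_Mapping.single u c = fscale c (monom us)"
      by (metis word.exhaust single_eq_fscale_monom)
    show ?case unfolding u fscale_mult_left contract_scale mult.assoc
      by (intro ext_ideal_scale word r)
  qed (simp add: distrib_right contract_add ext_ideal_closed)
  show ?thesis using q unfolding ext_ideal_def
  proof (induct rule: free.span_induct_alt)
    case base
    show ?case using ext_ideal_zero[of scale] by (simp add: contract_zero ext_ideal_def)
  next
    case (step c x y)
    then show ?case using gens
      by (fold ext_ideal_def) (auto simp: contract_add contract_scale intro!: ext_ideal_add ext_ideal_scale)
  qed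
qed

lemma lookup_mult_Nil:
  fixes p q :: "'v word \<Rightarrow>\<^sub>0 'k::field"
  shows "Poly_Mapping.lookup (p * q) (Word [])
       = Poly_Mapping.lookup p (Word []) * Poly_Mapping.lookup q (Word [])"
proof (induct p rule: free_induct)
  case (1 u c)
  show ?case
  proof (induct q rule: free_induct)
    case (1 w d)
    show ?case by (cases u; cases w) (auto simp: mult_single lookup_single when_def plus_word_def)
  qed (simp add: distrib_left lookup_add)
qed (simp add: distrib_right lookup_add)

text \<open>
  The coefficient of the empty word is multiplicative and vanishes on all relations, as they
  consist of words of length one and two.
\<close>
lemma one_notin_ext_ideal: "1 \<notin> ext_ideal (scale :: 'k::field \<Rightarrow> 'v::ab_group_add \<Rightarrow> 'v)"
proof -
  have "Poly_Mapping.lookup q (Word []) = 0" if "q \<in> ext_ideal scale" for q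
    using that unfolding ext_ideal_def
    by (induct rule: free.span_induct_alt)
      (auto simp: ext_rels_def lookup_add lookup_minus lookup_mult_Nil gen_def lookup_single)
  moreover have "Poly_Mapping.lookup (1 :: 'v word \<Rightarrow>\<^sub>0 'k) (Word []) = 1"
    by (simp flip: monom_Nil)
  ultimately show ?thesis by fastforce
qed

section \<open>Products of linearly independent vectors\<close>
locale exterior_algebra = vector_space scale
  for scale :: "'k::field \<Rightarrow> 'v::ab_group_add \<Rightarrow> 'v" (infixr "*s" 75)
begin

abbreviation indep_list :: "'v list \<Rightarrow> bool" where
  "indep_list vs \<equiv> distinct vs \<and> independent (set vs)"

lemma indep_list_Cons: "indep_list (x # xs) \<longleftrightarrow> indep_list xs \<and> x \<notin> span (set xs)"
  using span_base by (auto simp: independent_insert)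

lemma indep_list_snoc: "indep_list (xs @ [x]) \<longleftrightarrow> indep_list xs \<and> x \<notin> span (set xs)"
proof -
  have "indep_list (xs @ [x]) \<longleftrightarrow> indep_list (x # xs)" by auto
  then show ?thesis by (simp only: indep_list_Cons)
qed

lemma indep_list_append:
  assumes "indep_list (xs @ ys)"
  shows "indep_list xs" "indep_list ys"
  using assms independent_mono[of "set (xs @ ys)"] by auto

lemma subspace_gen_annihilator: "subspace {v. gen v * q \<in> ext_ideal scale}"
proof (rule subspaceI)
  have "gen (0 *s 0) - fscale 0 (gen 0) \<in> ext_ideal scale" by (rule gen_scale_in_ideal)
  then show "0 \<in> {v. gen v * q \<in> ext_ideal scale}" by (simp add: ext_ideal_mult_right)
next
  fix x y assume *: "x \<in> {v. gen v * q \<in> ext_ideal scale}" "y \<in> {v. gen v * q \<in> ext_ideal scale}"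
  have "gen (x + y) * q = (gen (x + y) - gen x - gen y) * q + gen x * q + gen y * q"
    by (simp add: algebra_simps)
  then show "x + y \<in> {v. gen v * q \<in> ext_ideal scale}"
    using * by (simp add: ext_ideal_add ext_ideal_mult_right gen_add_in_ideal)
next
  fix c x assume *: "x \<in> {v. gen v * q \<in> ext_ideal scale}"
  have "gen (c *s x) * q = (gen (c *s x) - fscale c (gen x)) * q + fscale c (gen x * q)"
    by (simp add: algebra_simps fscale_mult_left)
  then show "c *s x \<in> {v. gen v * q \<in> ext_ideal scale}"
    using * by (simp add: ext_ideal_closed ext_ideal_mult_right gen_scale_in_ideal)
qed

lemma gen_span_in_ideal: "v \<in> span (set vs) \<Longrightarrow> gen v * monom vs \<in> ext_ideal scale"
  using span_minimal[OF _ subspace_gen_annihilator, of "set vs" "monom vs"] gen_monom_in_ideal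
  by blast

text \<open>
  Contraction with a linear form that is \<open>1\<close> on the first vector and \<open>0\<close> on the others removes
  the first factor and stays in the ideal. Such a form exists by linear independence.
\<close>
lemma monom_notin_ideal: "indep_list vs \<Longrightarrow> monom vs \<notin> ext_ideal scale"
proof (induct vs)
  case Nil
  show ?case unfolding monom_Nil by (rule one_notin_ext_ideal)
next
  case (Cons x xs)
  show ?case
  proof
    assume *: "monom (x # xs) \<in> ext_ideal scale"
    define E where "E = extend_basis (set (x # xs))"
    have E: "independent E" "span E = UNIV" "set (x # xs) \<subseteq> E"
      using Cons(2) independent_extend_basis span_extend_basis extend_basis_superset
      unfolding E_def by blast+
    define f where "f y = representation E y x" for y
    have f_basis: "f y = (if y = x then 1 else 0)" if "y \<in> set (x # xs)" for y
      using that E representation_basis[of E y] by (auto simp: f_def)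
    have "contract f (monom (x # xs)) \<in> ext_ideal scale"
      using E by (intro contract_in_ideal * )
        (simp_all add: f_def representation_add representation_scale)
    moreover have "contract_letters f ys = 0" if "set ys \<subseteq> set xs" for ys
      using that Cons(2) by (induct ys) (auto simp: f_basis)
    then have "contract f (monom (x # xs)) = monom xs"
      by (simp add: contract_monom f_basis)
    ultimately show False using Cons indep_list_Cons by auto
  qed
qed

lemma monom_in_ideal_iff: "monom vs \<in> ext_ideal scale \<longleftrightarrow> \<not> indep_list vs"
proof
  assume "\<not> indep_list vs"
  then show "monom vs \<in> ext_ideal scale"
  proof (induct vs)
    case (Cons x xs)
    then have "monom xs \<in> ext_ideal scale \<or> x \<in> span (set xs)"
      using indep_list_Cons by blast
    then show ?case
      unfolding monom_Cons using ext_ideal_mult_left gen_span_in_ideal by blast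
  qed (simp add: independent_empty)
qed (use monom_notin_ideal in blast)

text \<open>
  The span of the factors can be recovered from the product. For a vector \<open>v\<close> outside the span,
  \<open>v # vs\<close> is again linearly independent, so its product is nonzero.
\<close>
lemma gen_annihilator_monom:
  assumes "indep_list vs"
  shows "{v. gen v * monom vs \<in> ext_ideal scale} = span (set vs)"
  using assms indep_list_Cons monom_in_ideal_iff
  by (auto simp: gen_span_in_ideal simp flip: monom_Cons)

lemma span_eq_of_ext_class_eq:
  assumes "indep_list vs" "c \<noteq> 0" "indep_list ws" "d \<noteq> 0"
    and "ext_class scale (fscale c (monom vs)) = ext_class scale (fscale d (monom ws))"
  shows "span (set vs) = span (set ws)"
proof -
  have "gen v * monom vs \<in> ext_ideal scale \<longleftrightarrow> gen v * monom ws \<in> ext_ideal scale" for v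
  proof -
    have "ext_class scale (gen v * fscale c (monom vs)) = ext_class scale (gen v * fscale d (monom ws))"
      using assms(5) by (simp only: flip: ext_mult_class)
    then have "gen v * fscale c (monom vs) \<in> ext_ideal scale
        \<longleftrightarrow> gen v * fscale d (monom ws) \<in> ext_ideal scale"
      by (rule ext_ideal_cong)
    then show ?thesis
      by (simp only: fscale_mult_right fscale_in_ideal_iff[OF assms(2)] fscale_in_ideal_iff[OF assms(4)])
  qed
  then show ?thesis
    using gen_annihilator_monom assms(1,3) by auto
qed

text \<open>
  This removes the distinction between extensors of step \<open>0\<close>, which are arbitrary nonzero scalars,
  and those of positive step: all are nonzero multiples of a product of independent vectors.
\<close>
lemma extensor_factorsE:
  assumes "extensor_factors scale vs A"
  obtains c where "c \<noteq> 0" "indep_list vs" "A = ext_class scale (fscale c (monom vs))"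
proof (cases "vs = []")
  case True
  then obtain c where "A = ext_class scale (fscale c (monom vs))" "A \<noteq> ext_class scale 0"
    using assms by (auto simp: extensor_factors_def ext_zero_def monom_Nil)
  moreover from this have "c \<noteq> 0" by auto
  ultimately show ?thesis using that True by (simp add: independent_empty)
next
  case False
  then have "A \<noteq> ext_zero scale \<and> A = wedge scale vs"
    using assms by (metis extensor_factors_def)
  then have A: "A = ext_class scale (fscale 1 (monom vs))" and nz: "A \<noteq> ext_class scale 0"
    unfolding ext_zero_def wedge_eq free.scale_one by blast+
  have "monom vs \<notin> ext_ideal scale"
  proof
    assume "monom vs \<in> ext_ideal scale"
    then have "A = ext_class scale 0" unfolding A ext_class_eq_iff by simp
    then show False using nz by contradiction
  qed
  then show ?thesis using that[of 1] A monom_in_ideal_iff by simp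
qed

text \<open>
  A scalar can be absorbed in the first factor; if there is none, it is itself an extensor.
\<close>
lemma extensor_factors_exist:
  assumes "indep_list vs" "c \<noteq> 0"
  obtains ws where "extensor_factors scale ws (ext_class scale (fscale c (monom vs)))"
proof -
  let ?A = "ext_class scale (fscale c (monom vs))"
  have "fscale c (monom vs) \<notin> ext_ideal scale"
    using assms fscale_in_ideal_iff monom_in_ideal_iff by blast
  then have nz: "?A \<noteq> ext_zero scale" by (simp add: ext_zero_def ext_class_eq_iff)
  show thesis
  proof (cases vs)
    case Nil
    have "extensor_factors scale [] ?A"
      using nz unfolding extensor_factors_def Nil monom_Nil by auto
    then show ?thesis by (rule that)
  next
    case (Cons x xs)
    have "(gen (c *s x) - fscale c (gen x)) * monom xs \<in> ext_ideal scale"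
      by (intro ext_ideal_mult_right gen_scale_in_ideal)
    then have "monom ((c *s x) # xs) - fscale c (monom (x # xs)) \<in> ext_ideal scale"
      by (simp only: monom_Cons left_diff_distrib fscale_mult_left)
    then have "?A = wedge scale ((c *s x) # xs)"
      unfolding wedge_eq Cons by (metis ext_class_eq_iff)
    then have "extensor_factors scale ((c *s x) # xs) ?A"
      using nz by (simp add: extensor_factors_def)
    then show ?thesis by (rule that)
  qed
qed

lemma extensor_ext_class:
  assumes "indep_list vs" "c \<noteq> 0"
  shows "extensor scale (ext_class scale (fscale c (monom vs)))"
    and "ext_space scale (ext_class scale (fscale c (monom vs))) = span (set vs)"
proof -
  let ?A = "ext_class scale (fscale c (monom vs))"
  obtain ws where ws: "extensor_factors scale ws ?A" using extensor_factors_exist[OF assms] .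
  then show "extensor scale ?A" by (auto simp: extensor_def)
  have "span (set us) = span (set vs)" if "extensor_factors scale us ?A" for us
    using that assms by (elim extensor_factorsE) (metis span_eq_of_ext_class_eq)
  then show "ext_space scale ?A = span (set vs)"
    unfolding ext_space_def using ws by (intro the_equality) metis+
qed

lemma extensorE:
  assumes "extensor scale A"
  obtains vs c where "c \<noteq> 0" "indep_list vs" "A = ext_class scale (fscale c (monom vs))"
  using assms extensor_factorsE unfolding extensor_def by metis

section \<open>Exchange of factors\<close>

text \<open>
  Let \<open>f\<close> be the letter after \<open>es\<close>. If \<open>v\<close> lies in the span of \<open>es\<close> and \<open>f\<close>, then \<open>v\<close> is \<open>k f\<close>
  with \<open>k \<noteq> 0\<close> plus a vector in the span of \<open>es\<close>, which does not contribute to the product, so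
  \<open>v\<close> can take the place of \<open>f\<close>. Otherwise \<open>f\<close> is skipped: it is treated as part of \<open>es\<close> and swapped with \<open>v\<close> afterwards.
\<close>
lemma exchange_letter:
  assumes "v \<in> span (set (es @ fs))" "v \<notin> span (set es)"
  shows "\<exists>fs' c. c \<noteq> 0 \<and>
    ext_class scale (monom (es @ fs)) = ext_class scale (fscale c (monom (es @ v # fs')))"
  using assms
proof (induct fs arbitrary: es)
  case (Cons f fs)
  show ?case
  proof (cases "v \<in> span (set (es @ [f]))")
    case True
    then obtain k where s: "v - k *s f \<in> span (set es)" by (auto simp: span_breakdown_eq)
    define s where "s = v - k *s f"
    have k: "k \<noteq> 0" using s Cons(3) by auto
    have es_s: "monom es * gen s \<in> ext_ideal scale"
    proof -
      have "gen s * monom es \<in> ext_ideal scale" using s gen_span_in_ideal unfolding s_def by blast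
      moreover have "monom (s # es) \<in> ext_ideal scale \<longleftrightarrow> monom (es @ [s]) \<in> ext_ideal scale"
        unfolding monom_in_ideal_iff by auto
      ultimately show ?thesis by (simp only: monom_append monom_Cons monom_Nil mult_1_right)
    qed
    \<comment> \<open>multilinear expansion of \<open>v = k f + s\<close>; each summand lies in the ideal\<close>
    have "monom (es @ v # fs) - fscale k (monom (es @ f # fs))
        = monom es * (gen (k *s f + s) - gen (k *s f) - gen s) * monom fs
        + monom es * (gen (k *s f) - fscale k (gen f)) * monom fs + monom es * gen s * monom fs"
      unfolding s_def monom_append monom_Cons
      by (simp add: algebra_simps fscale_mult_left fscale_mult_right)
    also have "\<dots> \<in> ext_ideal scale"
      by (intro ext_ideal_add ext_ideal_mult gen_add_in_ideal gen_scale_in_ideal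
          ext_ideal_mult_right[OF es_s])
    finally have "fscale (- inverse k) (monom (es @ v # fs) - fscale k (monom (es @ f # fs))) \<in> ext_ideal scale"
      by (rule ext_ideal_scale)
    then have "ext_class scale (monom (es @ f # fs)) = ext_class scale (fscale (inverse k) (monom (es @ v # fs)))"
      using k unfolding ext_class_eq_iff
      by (simp add: free.scale_right_diff_distrib single_uminus del: fscale_single)
    then show ?thesis using k by (intro exI[of _ fs] exI[of _ "inverse k"]) simp
  next
    case False
    then obtain fs' c where c: "c \<noteq> 0" and
      *: "ext_class scale (monom (es @ f # fs)) = ext_class scale (fscale c (monom (es @ f # v # fs')))"
      using Cons(1)[of "es @ [f]"] Cons(2) by auto
    have "fscale c (monom es * (gen f * gen v + gen v * gen f) * monom fs') \<in> ext_ideal scale"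
      by (intro ext_ideal_scale ext_ideal_mult gen_anticommute_in_ideal)
    then have "fscale c (monom (es @ f # v # fs')) - fscale (- c) (monom (es @ v # f # fs')) \<in> ext_ideal scale"
      unfolding monom_append monom_Cons
      by (simp add: algebra_simps)
    then have "ext_class scale (monom (es @ f # fs)) = ext_class scale (fscale (- c) (monom (es @ v # f # fs')))"
      unfolding * by (simp only: ext_class_eq_iff)
    then show ?thesis using c by (intro exI[of _ "f # fs'"] exI[of _ "- c"]) simp
  qed
qed simp

lemma exchange_list:
  assumes us: "indep_list us" and "indep_list es" "set es \<subseteq> span (set us)"
  shows "\<exists>fs c. c \<noteq> 0 \<and> indep_list (es @ fs) \<and> span (set (es @ fs)) = span (set us) \<and>
    ext_class scale (monom us) = ext_class scale (fscale c (monom (es @ fs)))"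
  using assms(2,3)
proof (induct es rule: rev_induct)
  case Nil
  show ?case using us by (intro exI[of _ us] exI[of _ 1]) simp
next
  case (snoc v es)
  have "indep_list es" and v: "v \<notin> span (set es)"
    using snoc(2) by (simp_all only: indep_list_snoc simp_thms)
  with snoc obtain fs c where c: "c \<noteq> 0" and fs: "span (set (es @ fs)) = span (set us)"
    and eq: "ext_class scale (monom us) = ext_class scale (fscale c (monom (es @ fs)))"
    by auto
  have "v \<in> span (set (es @ fs))" using snoc(3) fs by simp
  then obtain fs' d where d: "d \<noteq> 0" and
    *: "ext_class scale (monom (es @ fs)) = ext_class scale (fscale d (monom (es @ v # fs')))"
    using exchange_letter v by blast
  have "fscale c (monom (es @ fs) - fscale d (monom (es @ v # fs'))) \<in> ext_ideal scale"
    using * by (intro ext_ideal_scale) (simp only: ext_class_eq_iff)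
  then have us': "ext_class scale (monom us) = ext_class scale (fscale (c * d) (monom (es @ v # fs')))"
    unfolding eq ext_class_eq_iff by (simp only: free.scale_right_diff_distrib free.scale_scale)
  \<comment> \<open>independence comes for free: the product of the new list is still nonzero\<close>
  have ind: "indep_list (es @ v # fs')"
  proof (rule ccontr)
    assume "\<not> ?thesis"
    then have "ext_class scale (monom us) = ext_class scale 0"
      unfolding us' ext_class_eq_iff diff_0_right
      using monom_in_ideal_iff by (intro ext_ideal_scale) blast
    then show False using us monom_in_ideal_iff by (simp add: ext_class_eq_iff)
  qed
  then have "span (set us) = span (set (es @ v # fs'))"
    using us' us c d by (intro span_eq_of_ext_class_eq[of us 1 _ "c * d"]) auto
  then show ?case using us' ind c d by (intro exI[of _ fs'] exI[of _ "c * d"]) auto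
qed

section \<open>Adapted bases of a pair of extensors\<close>

text \<open>
  A relation that expresses a vector of \<open>gs\<close> by \<open>fs\<close> and the rest would give a vector of the
  span of \<open>fs\<close> lying in both spans, hence in the span of \<open>es\<close>.
\<close>
lemma indep_list_glue:
  assumes "indep_list (es @ fs)" "indep_list (es @ gs)"
    and "span (set (es @ fs)) \<inter> span (set (es @ gs)) \<subseteq> span (set es)"
  shows "indep_list (fs @ es @ gs)"
  using assms(2,3)
proof (induct gs rule: rev_induct)
  case Nil
  show ?case using assms(1) by (auto simp: Un_commute)
next
  case (snoc g gs)
  have gs: "indep_list (es @ gs)" and g: "g \<notin> span (set (es @ gs))"
    using snoc(2) unfolding append_assoc[symmetric] by (simp_all only: indep_list_snoc simp_thms)
  have "span (set (es @ gs)) \<subseteq> span (set (es @ gs @ [g]))" by (intro span_mono) auto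
  then have IH: "indep_list (fs @ es @ gs)" using snoc(1,3) gs by blast
  have "g \<notin> span (set fs \<union> set (es @ gs))"
  proof
    assume "g \<in> span (set fs \<union> set (es @ gs))"
    then obtain x y where xy: "g = x + y" "x \<in> span (set fs)" "y \<in> span (set (es @ gs))"
      unfolding span_Un by blast
    have "x \<in> span (set (es @ fs))" using xy(2) span_mono[of "set fs" "set (es @ fs)"] by auto
    moreover have "g - y \<in> span (set (es @ gs @ [g]))"
      using xy(3) span_mono[of "set (es @ gs)" "set (es @ gs @ [g])"]
      by (intro span_diff) (auto intro: span_base)
    ultimately have "x \<in> span (set es)" using snoc(3) xy(1) by auto
    then have "x \<in> span (set (es @ gs))" using span_mono[of "set es" "set (es @ gs)"] by auto
    then show False using g xy span_add by blast
  qed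
  then have "indep_list (g # (fs @ es @ gs))"
    using IH unfolding indep_list_Cons by simp
  then show ?case by (auto simp: insert_commute)
qed

lemma dim_span_indep_list: "indep_list vs \<Longrightarrow> dim (span (set vs)) = length vs"
  using dim_span_eq_card_independent[of "set vs"] distinct_card[of vs] by simp

lemma ext_class_fscale_cong:
  assumes "ext_class scale p = ext_class scale (fscale c q)"
  shows "ext_class scale (fscale a p) = ext_class scale (fscale (a * c) q)"
  using assms ext_ideal_scale[of "p - fscale c q" scale a]
  by (simp add: ext_class_eq_iff free.scale_right_diff_distrib)

text \<open>
  The normal form of a pair of extensors on which the geometric products become transparent:
  \<open>es\<close> is a basis of the meet, and \<open>fs\<close> and \<open>gs\<close> extend it to bases of the two spaces.
\<close>
lemma extensor_pairE:
  assumes "extensor scale A" "extensor scale B"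
  obtains es fs gs a b where "a \<noteq> 0" "b \<noteq> 0" "indep_list (fs @ es @ gs)"
    "A = ext_class scale (fscale a (monom (es @ fs)))"
    "B = ext_class scale (fscale b (monom (es @ gs)))"
    "ext_space scale A \<inter> ext_space scale B = span (set es)"
proof -
  obtain us a where us: "a \<noteq> 0" "indep_list us" and A: "A = ext_class scale (fscale a (monom us))"
    using extensorE[OF assms(1)] .
  obtain ws b where ws: "b \<noteq> 0" "indep_list ws" and B: "B = ext_class scale (fscale b (monom ws))"
    using extensorE[OF assms(2)] .
  let ?S = "span (set us) \<inter> span (set ws)"
  obtain E where E: "E \<subseteq> ?S" "independent E" "?S \<subseteq> span E" by (metis basis_exists)
  have "finite E" using E independent_span_bound[of "set us" E] by auto
  then obtain es where es: "set es = E" "distinct es" using finite_distinct_list by blast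
  obtain fs c where fs: "c \<noteq> 0" "indep_list (es @ fs)" "span (set (es @ fs)) = span (set us)"
    "ext_class scale (monom us) = ext_class scale (fscale c (monom (es @ fs)))"
    using exchange_list[OF us(2), of es] es E by auto
  obtain gs d where gs: "d \<noteq> 0" "indep_list (es @ gs)" "span (set (es @ gs)) = span (set ws)"
    "ext_class scale (monom ws) = ext_class scale (fscale d (monom (es @ gs)))"
    using exchange_list[OF ws(2), of es] es E by auto
  have "span E \<subseteq> ?S"
    using E(1) by (intro span_minimal subspace_inter) auto
  then have S: "?S = span (set es)" using E(3) es by blast
  show thesis
  proof (rule that)
    show "a * c \<noteq> 0" "b * d \<noteq> 0" using us ws fs gs by auto
    show "A = ext_class scale (fscale (a * c) (monom (es @ fs)))"
      "B = ext_class scale (fscale (b * d) (monom (es @ gs)))"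
      unfolding A B by (intro ext_class_fscale_cong fs gs)+
    show "indep_list (fs @ es @ gs)"
      using S fs gs by (intro indep_list_glue) auto
    show "ext_space scale A \<inter> ext_space scale B = span (set es)"
      unfolding A B extensor_ext_class(2)[OF us(2,1)] extensor_ext_class(2)[OF ws(2,1)] by (rule S)
  qed
qed

end

section \<open>Geometric products of words with common letters\<close>
lemma nths_prefix: "nths (xs @ ys) {..<length xs} = xs"
  by (simp add: nths_append)

lemma nths_suffix: "nths (xs @ ys) ({..<length (xs @ ys)} - {..<length xs}) = ys"
proof -
  have "nths xs ({..<length (xs @ ys)} - {..<length xs}) = []"
    by (auto simp: set_nths simp flip: set_empty)
  moreover have "nths ys {j. j + length xs \<in> {..<length (xs @ ys)} - {..<length xs}} = ys"
    by (intro nths_all) auto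
  ultimately show ?thesis by (simp add: nths_append)
qed

lemma nth_in_set_nths: "i < length xs \<Longrightarrow> i \<in> I \<Longrightarrow> xs ! i \<in> set (nths xs I)"
  by (auto simp: set_nths)

lemma split_sign_neq_0: "(of_int (split_sign n I) :: 'k::field) \<noteq> 0"
  by (simp add: split_sign_def sign_def)

lemma ext2_null_single:
  fixes scale :: "'k::field \<Rightarrow> 'v::ab_group_add \<Rightarrow> 'v"
  assumes "monom u \<in> ext_ideal scale \<or> monom w \<in> ext_ideal scale"
  shows "Poly_Mapping.single (Word u, Word w) s \<in> ext2_null scale"
proof -
  have "Poly_Mapping.single (Word u, Word w) s = fscale s (ftensor (monom u) (monom w))" by simp
  then show ?thesis
    using assms ext2_null_left ext2_null_right free.subspace_scale[OF subspace_ext2_null] by metis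
qed

lemma sum_single_survivor_ext2_null:
  assumes "finite T" "\<And>I. I \<in> T \<Longrightarrow> I \<noteq> K \<Longrightarrow> F I \<in> ext2_null scale"
  shows "sum F T - (if K \<in> T then F K else 0) \<in> ext2_null scale"
proof -
  have "sum F T - (if K \<in> T then F K else 0) = sum F (T - {K})"
    using assms(1) by (auto simp: sum_diff1)
  then show ?thesis
    using assms(2) by (auto intro: free.subspace_sum[OF subspace_ext2_null])
qed

text \<open>
  In the sum over \<open>I\<close>, the positions in \<open>I\<close> are those that stay in the first factor. If not all
  letters of \<open>es\<close> stay, one of them is multiplied by its copy in \<open>ws\<close>. Staying positions number
  at most \<open>length es\<close>, since \<open>h \<ge> length fs\<close>; so if all letters of \<open>es\<close> stay, nothing else does.
\<close>
lemma word_diamond21_common_prefix: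
  fixes scale :: "'k::field \<Rightarrow> 'v::ab_group_add \<Rightarrow> 'v"
  assumes sub: "set es \<subseteq> set ws" and h: "length fs \<le> h"
  shows "word_diamond21 h (Word (es @ fs), Word ws)
    - (if h = length fs then Poly_Mapping.single (Word es, Word (fs @ ws))
         (of_int (split_sign (length (es @ fs)) {..<length es})) else 0) \<in> ext2_null scale"
proof -
  let ?n = "length (es @ fs)" and ?K = "{..<length es}"
  let ?T = "term_set ?n (int ?n - int h) (int h)"
  let ?F = "slice_term 0 (Word ws) (es @ fs) :: nat set \<Rightarrow> (_ \<Rightarrow>\<^sub>0 'k)"
  have "?F I \<in> ext2_null scale" if I: "I \<in> ?T" "I \<noteq> ?K" for I
  proof -
    have I': "I \<subseteq> {..<?n}" "int (card I) = int ?n - int h" using I by (auto simp: term_set_def)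
    have "\<not> ?K \<subseteq> I"
    proof
      assume "?K \<subseteq> I"
      moreover have "finite I" using I' finite_subset by blast
      moreover have "card I \<le> card ?K" using I' h by simp
      ultimately show False using I card_seteq by metis
    qed
    then obtain i where i: "i < length es" "i \<notin> I" by auto
    then have "es ! i \<in> set (nths (es @ fs) ({..<?n} - I))"
      using nth_in_set_nths[of i "es @ fs" "{..<?n} - I"] by (simp add: nth_append)
    moreover have "es ! i \<in> set ws" using i sub by auto
    ultimately show ?thesis unfolding slice_term_def
      by (auto simp: plus_word_def intro!: ext2_null_single monom_repeat_in_ideal)
  qed
  then have "sum ?F ?T - (if ?K \<in> ?T then ?F ?K else 0) \<in> ext2_null scale"
    by (intro sum_single_survivor_ext2_null) (auto simp: term_set_def)
  moreover have "?K \<in> ?T \<longleftrightarrow> h = length fs"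
    by (auto simp: term_set_def card_Diff_subset)
  moreover have "?F ?K = Poly_Mapping.single (Word es, Word (fs @ ws)) (of_int (split_sign ?n ?K))"
    unfolding slice_term_def nths_prefix nths_suffix by (simp add: plus_word_def zero_word_def)
  ultimately show ?thesis by (simp only: word_diamond21_eq)
qed

text \<open>
  The mirror image: the positions in \<open>I\<close> are now those that move to the first factor, where a letter
  of \<open>es\<close> meets its copy in \<open>us\<close>. If only letters of \<open>gs\<close> move, then all of them do,
  since \<open>h \<ge> length gs\<close>. The surviving set is the complement of an initial segment, so
  its sign need not be \<open>1\<close>.
\<close>
lemma word_diamond12_common_prefix:
  fixes scale :: "'k::field \<Rightarrow> 'v::ab_group_add \<Rightarrow> 'v"
  assumes sub: "set es \<subseteq> set us" and h: "length gs \<le> h"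
  shows "word_diamond12 h (Word us, Word (es @ gs))
    - (if h = length gs then Poly_Mapping.single (Word (us @ gs), Word es)
         (of_int (split_sign (length (es @ gs)) ({..<length (es @ gs)} - {..<length es}))) else 0)
    \<in> ext2_null scale"
proof -
  let ?n = "length (es @ gs)"
  let ?E = "{..<length es}"
  let ?K = "{..<?n} - ?E"
  let ?T = "term_set ?n (int h) (int ?n - int h)"
  let ?F = "slice_term (Word us) 0 (es @ gs) :: nat set \<Rightarrow> (_ \<Rightarrow>\<^sub>0 'k)"
  have cardK: "card ?K = length gs" by (simp add: card_Diff_subset)
  have compl: "{..<?n} - ?K = ?E" by auto
  have "?F I \<in> ext2_null scale" if I: "I \<in> ?T" "I \<noteq> ?K" for I
  proof -
    have I': "I \<subseteq> {..<?n}" "card I = h" using I by (auto simp: term_set_def)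
    have "\<not> I \<subseteq> ?K"
      using I(2) card_seteq[of ?K I] cardK I'(2) h by auto
    then obtain i where "i \<in> I" "i \<notin> ?K" by blast
    then have i: "i < length es" "i \<in> I" using I' by auto
    then have "es ! i \<in> set (nths (es @ gs) I)"
      using nth_in_set_nths[of i "es @ gs" I] by (simp add: nth_append)
    moreover have "es ! i \<in> set us" using i sub by auto
    ultimately show ?thesis unfolding slice_term_def
      by (auto simp: plus_word_def intro!: ext2_null_single monom_repeat_in_ideal)
  qed
  then have "sum ?F ?T - (if ?K \<in> ?T then ?F ?K else 0) \<in> ext2_null scale"
    by (intro sum_single_survivor_ext2_null) (auto simp: term_set_def)
  moreover have "?K \<in> ?T \<longleftrightarrow> h = length gs"
    unfolding term_set_def mem_Collect_eq compl cardK by auto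
  moreover have "?F ?K = Poly_Mapping.single (Word (us @ gs), Word es) (of_int (split_sign ?n ?K))"
    unfolding slice_term_def compl nths_prefix nths_suffix by (simp add: plus_word_def zero_word_def)
  ultimately show ?thesis by (simp only: word_diamond12_eq)
qed

lemma ext2_class_fscale_cong:
  assumes "x - y \<in> ext2_null scale"
  shows "ext2_class scale (fscale c x) = ext2_class scale (fscale c y)"
  using free.subspace_scale[OF subspace_ext2_null assms, of c]
  by (simp add: ext2_class_eq_iff free.scale_right_diff_distrib)

text \<open>
  The scalars of \<open>A\<close> and \<open>B\<close> and the sign of the surviving term are collected in the first factor,
  which makes the result a tensor product of two multiples of words.
\<close>
lemma diamond21_common_prefix:
  fixes scale :: "'k::field \<Rightarrow> 'v::ab_group_add \<Rightarrow> 'v"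
  defines "s \<equiv> \<lambda>es fs. of_int (split_sign (length (es @ fs)) {..<length es})"
  assumes "set es \<subseteq> set ws" "length fs \<le> h"
  shows "diamond21 scale h (ext_tensor scale (ext_class scale (fscale a (monom (es @ fs))))
      (ext_class scale (fscale b (monom ws)))) =
    (if h = length fs
     then ext_tensor scale (ext_class scale (fscale (a * b * s es fs) (monom es)))
       (ext_class scale (fscale 1 (monom (fs @ ws))))
     else ext2_zero scale)"
proof -
  have "diamond21 scale h (ext_tensor scale (ext_class scale (fscale a (monom (es @ fs))))
      (ext_class scale (fscale b (monom ws))))
      = ext2_class scale (fscale (a * b) (word_diamond21 h (Word (es @ fs), Word ws)))"
    by (simp add: ext_tensor_class diamond21_class)
  also have "\<dots> = ext2_class scale (fscale (a * b)
      (if h = length fs then Poly_Mapping.single (Word es, Word (fs @ ws)) (s es fs) else 0))"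
    unfolding s_def by (intro ext2_class_fscale_cong word_diamond21_common_prefix assms(2,3))
  finally show ?thesis
    by (auto simp: ext_tensor_class ext2_zero_def)
qed

lemma diamond12_common_prefix:
  fixes scale :: "'k::field \<Rightarrow> 'v::ab_group_add \<Rightarrow> 'v"
  defines "s \<equiv> \<lambda>es gs. of_int (split_sign (length (es @ gs)) ({..<length (es @ gs)} - {..<length es}))"
  assumes "set es \<subseteq> set us" "length gs \<le> h"
  shows "diamond12 scale h (ext_tensor scale (ext_class scale (fscale a (monom us)))
      (ext_class scale (fscale b (monom (es @ gs))))) =
    (if h = length gs
     then ext_tensor scale (ext_class scale (fscale (a * b * s es gs) (monom (us @ gs))))
       (ext_class scale (fscale 1 (monom es)))
     else ext2_zero scale)"
proof -
  have "diamond12 scale h (ext_tensor scale (ext_class scale (fscale a (monom us)))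
      (ext_class scale (fscale b (monom (es @ gs)))))
      = ext2_class scale (fscale (a * b) (word_diamond12 h (Word us, Word (es @ gs))))"
    by (simp add: ext_tensor_class diamond12_class)
  also have "\<dots> = ext2_class scale (fscale (a * b)
      (if h = length gs then Poly_Mapping.single (Word (us @ gs), Word es) (s es gs) else 0))"
    unfolding s_def by (intro ext2_class_fscale_cong word_diamond12_common_prefix assms(2,3))
  finally show ?thesis
    by (auto simp: ext_tensor_class ext2_zero_def)
qed


section \<open>Meet and join from the geometric products\<close>

theorem proposition1:
  fixes scale :: "'k::field \<Rightarrow> 'v::ab_group_add \<Rightarrow> 'v"
    and Basis :: "'v set"
    and A B :: "('v word \<Rightarrow>\<^sub>0 'k) set"
    and p p' :: nat
  assumes V: "finite_dimensional_vector_space scale Basis"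
    and A: "extensor scale A"
    and B: "extensor scale B"
    and p: "p = vector_space.dim scale (ext_space scale A)
              - vector_space.dim scale (ext_space scale A \<inter> ext_space scale B)"
    and p': "p' = vector_space.dim scale (ext_space scale B)
              - vector_space.dim scale (ext_space scale A \<inter> ext_space scale B)"
  shows
    "p = vector_space.dim scale (ext_space scale A + ext_space scale B)
           - vector_space.dim scale (ext_space scale B)
     \<and> (\<exists>C D. extensor scale C \<and> extensor scale D
           \<and> ext_space scale C = ext_space scale A \<inter> ext_space scale B
           \<and> ext_space scale D = ext_space scale A + ext_space scale B
           \<and> diamond21 scale p (ext_tensor scale A B) = ext_tensor scale C D)
     \<and> (\<forall>h>p. diamond21 scale h (ext_tensor scale A B) = ext2_zero scale)
     \<and> (\<exists>C' D'. extensor scale C' \<and> extensor scale D'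
           \<and> ext_space scale C' = ext_space scale A + ext_space scale B
           \<and> ext_space scale D' = ext_space scale A \<inter> ext_space scale B
           \<and> diamond12 scale p' (ext_tensor scale A B) = ext_tensor scale C' D')
     \<and> (\<forall>h>p'. diamond12 scale h (ext_tensor scale A B) = ext2_zero scale)"
proof -
  interpret finite_dimensional_vector_space scale Basis by (rule V)
  interpret exterior_algebra scale by unfold_locales
  obtain es fs gs a b where ab: "a \<noteq> 0" "b \<noteq> 0" and ind: "indep_list (fs @ es @ gs)"
    and A_eq: "A = ext_class scale (fscale a (monom (es @ fs)))"
    and B_eq: "B = ext_class scale (fscale b (monom (es @ gs)))"
    and meet: "ext_space scale A \<inter> ext_space scale B = span (set es)"
    using extensor_pairE[OF A B] .
  \<comment> \<open>the order in which the basis of the join appears in the second product\<close>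
  have efg: "indep_list ((es @ fs) @ gs)" using ind by (auto simp: Un_ac)
  have ef: "indep_list (es @ fs)" and eg: "indep_list (es @ gs)" and e: "indep_list es"
    using indep_list_append(1)[OF efg] indep_list_append(2)[OF ind] indep_list_append(1) by blast+
  have space_A: "ext_space scale A = span (set (es @ fs))"
    unfolding A_eq by (rule extensor_ext_class[OF ef ab(1)])
  have space_B: "ext_space scale B = span (set (es @ gs))"
    unfolding B_eq by (rule extensor_ext_class[OF eg ab(2)])
  have sum_span: "span S + span T = span (S \<union> T)" for S T
    unfolding span_Un set_plus_def by auto
  have join: "ext_space scale A + ext_space scale B = span (set (fs @ es @ gs))"
    unfolding space_A space_B sum_span by (intro arg_cong[of _ _ span]) auto
  have join': "ext_space scale A + ext_space scale B = span (set ((es @ fs) @ gs))"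
    unfolding join by (intro arg_cong[of _ _ span]) auto
  have p_eq: "p = length fs" and p'_eq: "p' = length gs"
    unfolding p p' meet unfolding space_A space_B dim_span_indep_list[OF ef]
      dim_span_indep_list[OF eg] dim_span_indep_list[OF e] by simp_all
  have "p = dim (ext_space scale A + ext_space scale B) - dim (ext_space scale B)"
    unfolding join unfolding space_B dim_span_indep_list[OF ind] dim_span_indep_list[OF eg] p_eq by simp
  moreover have "\<exists>C D. extensor scale C \<and> extensor scale D
      \<and> ext_space scale C = ext_space scale A \<inter> ext_space scale B
      \<and> ext_space scale D = ext_space scale A + ext_space scale B
      \<and> diamond21 scale p (ext_tensor scale A B) = ext_tensor scale C D"
  proof -
    define c :: 'k where "c = a * b * of_int (split_sign (length (es @ fs)) {..<length es})"
    have "c \<noteq> 0" using ab split_sign_neq_0 by (simp add: c_def)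
    moreover have "diamond21 scale p (ext_tensor scale A B)
        = ext_tensor scale (ext_class scale (fscale c (monom es)))
            (ext_class scale (fscale 1 (monom (fs @ es @ gs))))"
      unfolding A_eq B_eq c_def p_eq by (subst diamond21_common_prefix) auto
    ultimately show ?thesis
      unfolding meet join
      using extensor_ext_class[OF e] extensor_ext_class[OF ind one_neq_zero] by blast
  qed
  moreover have "\<forall>h>p. diamond21 scale h (ext_tensor scale A B) = ext2_zero scale"
    unfolding A_eq B_eq p_eq by (auto simp: diamond21_common_prefix simp del: fscale_single)
  moreover have "\<exists>C' D'. extensor scale C' \<and> extensor scale D'
      \<and> ext_space scale C' = ext_space scale A + ext_space scale B
      \<and> ext_space scale D' = ext_space scale A \<inter> ext_space scale B
      \<and> diamond12 scale p' (ext_tensor scale A B) = ext_tensor scale C' D'"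
  proof -
    define c :: 'k where "c = a * b *
      of_int (split_sign (length (es @ gs)) ({..<length (es @ gs)} - {..<length es}))"
    have "c \<noteq> 0" using ab split_sign_neq_0 by (simp add: c_def)
    moreover have "diamond12 scale p' (ext_tensor scale A B)
        = ext_tensor scale (ext_class scale (fscale c (monom ((es @ fs) @ gs))))
            (ext_class scale (fscale 1 (monom es)))"
      unfolding A_eq B_eq c_def p'_eq by (subst diamond12_common_prefix) auto
    ultimately show ?thesis
      unfolding meet join'
      using extensor_ext_class[OF efg] extensor_ext_class[OF e one_neq_zero] by blast
  qed
  moreover have "\<forall>h>p'. diamond12 scale h (ext_tensor scale A B) = ext2_zero scale"
    unfolding A_eq B_eq p'_eq by (auto simp: diamond12_common_prefix simp del: fscale_single)
  ultimately show ?thesis by blast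
qed

end
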